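(* Let $A\in\mathbb{R}^{n\times n}$ be neutrally stable and $C\in\mathbb{R}^{m\times n}$ be such that the pair $(A^T,C^T)$ is stabilizable. Let $L\in\mathbb{R}^{n\times m}$ be any matrix constructed from $(A,C)$ according to the Algorithm described in the context. Let $p\ge 1$ and let $\Lambda=[\lambda_{ij}]\in\mathbb{R}^{p\times p}$ be any connected matrix (in the discrete-time sense). Consider the $p$ coupled systems $$x_i(k+1)=A^Tx_i(k)+C^Tu_i(k),\qquad u_i(k)=L^Tz_i(k),\qquad z_i(k)=\sum_{j=1}^{p}\lambda_{ij}\big(x_j(k)-x_i(k)\big),$$ for $i=1,\dots,p$ and $k\in\mathbb{N}$, with arbitrary initial conditions $x_1(0),\dots,x_p(0)\in\mathbb{R}^n$. Let $r\in\mathbb{R}^p$ be such that $r^T\Lambda=r^T$ and $r^T\mathbf{1}=1$. Then the solutions $x_i(\cdot)$, $i=1,\dots,p$, synchronize to $$\bar x(k):=\big(r^T\otimes (A^k)^T\big)\begin{bmatrix}x_1(0)\\ \vdots\\ x_p(0)\end{bmatrix},$$ that is, $|x_i(k)-\bar x(k)|\to 0$ as $k\to\infty$ for every $i\in\{1,\dots,p\}$.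
   Context: $\mathbb{N}$ is the set of nonnegative integers, $|\cdot|$ is the 2-norm, $\otimes$ is the Kronecker product, and $\mathbf{1}\in\mathbb{R}^p$ is the vector with all entries equal to 1. Neutrally stable: $A\in\mathbb{R}^{n\times n}$ is neutrally stable (discrete-time sense) if it has no eigenvalue of magnitude greater than one and every Jordan block corresponding to an eigenvalue $\lambda$ with $|\lambda|=1$ is of size one. Detectable and stabilizable: $(C,A)$ is detectable (discrete-time sense) if, for $x\in\mathbb{R}^n$, $CA^kx=0$ for all $k\in\mathbb{N}$ implies $\lim_{k\to\infty}A^kx=0$. A pair $(A,B)$ is stabilizable if $(B^T,A^T)$ is detectable. In particular, $(A^T,C^T)$ is stabilizable iff $(C,A)$ is detectable. Connected matrix: the graph of $\Lambda=[\lambda_{ij}]\in\mathbb{R}^{p\times p}$ is the directed graph with nodes $n_1,\dots,n_p$ in which $(n_i,n_j)$ is an arc iff $\lambda_{ij}>0$. A path from $n_{i_1}$ to $n_{i_\ell}$ is a sequence of nodes $n_{i_1},\dots,n_{i_\ell}$ whose consecutive pairs $(n_{i_s},n_{i_{s+1}})$ are arcs. A directed graph is connected if it has a node to which there exists a path from every other node. $\Lambda$ is connected (discrete-time sense) if (i) $\lambda_{ii}>0$ and $\lambda_{ij}\ge 0$ for all $i,j$; (ii) each row of $\Lambda$ sums to 1; (iii) its graph is connected. Algorithm (construction of $L$ from $A$ and $C$, with $A$ neutrally stable): let $n_1\le n$ be the number of eigenvalues of $A$ of magnitude one (counted with multiplicity) and $n_2:=n-n_1$. If $n_1=0$, let $L:=0$.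 Otherwise: Step 1: choose $U\in\mathbb{R}^{n\times n_1}$ and $W\in\mathbb{R}^{n\times n_2}$ such that $[U\ W]$ is invertible and $$[U\ W]^{-1}A[U\ W]=\begin{bmatrix}F&0\\0&G\end{bmatrix},$$ where all the eigenvalues of $F\in\mathbb{R}^{n_1\times n_1}$ have magnitude one (so all eigenvalues of $G\in\mathbb{R}^{n_2\times n_2}$ have magnitude less than one). It is assumed that $CU$ has full row rank. Step 2: choose a symmetric positive definite $R\in\mathbb{R}^{n_1\times n_1}$ such that $F^TRF=R$ (such $R$ exists). Step 3: choose $H\in\mathbb{R}^{m\times n_1}$ satisfying $\mathrm{range}(H^T)=\mathrm{range}(R^{-1/2}U^TC^T)$ and $HH^T=I_m$ (then $CUR^{-1/2}H^T$ is invertible). Step 4: define $L:=UFR^{-1/2}H^T(CUR^{-1/2}H^T)^{-1}$. *)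

theory Defs
  imports
    Complex_Main
    "Jordan_Normal_Form.Jordan_Normal_Form_Existence"
    "Jordan_Normal_Form.DL_Rank"
    "Jordan_Normal_Form.Gauss_Jordan_Elimination"
begin

text \<open>Nodes and vector entries are numbered from \<open>0\<close>.  Matrix spectra are complex; \<open>cmat\<close>
  regards a real matrix as a complex one.\<close>

abbreviation cmat :: "real mat \<Rightarrow> complex mat" where
  "cmat A \<equiv> map_mat complex_of_real A"

text \<open>Meaningful only if \<open>A\<close> is square and invertible.\<close>

abbreviation mat_inv :: "'a :: field mat \<Rightarrow> 'a mat" where
  "mat_inv A \<equiv> the (mat_inverse A)"

definition vec_norm2 :: "real vec \<Rightarrow> real" where
  "vec_norm2 v = sqrt (v \<bullet> v)"

definition append_cols :: "'a :: zero mat \<Rightarrow> 'a mat \<Rightarrow> 'a mat" where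
  "append_cols U W = four_block_mat U W (0\<^sub>m 0 (dim_col U)) (0\<^sub>m 0 (dim_col W))"

definition kronecker_prod :: "'a :: times mat \<Rightarrow> 'a mat \<Rightarrow> 'a mat" where
  "kronecker_prod A B = mat (dim_row A * dim_row B) (dim_col A * dim_col B)
     (\<lambda>(i, j). A $$ (i div dim_row B, j div dim_col B) * B $$ (i mod dim_row B, j mod dim_col B))"

text \<open>\<open>stack_vecs p n v\<close> is the block column of \<open>v 0, \<dots>, v (p - 1)\<close>, each of dimension \<open>n\<close>.\<close>

definition stack_vecs :: "nat \<Rightarrow> nat \<Rightarrow> (nat \<Rightarrow> 'a vec) \<Rightarrow> 'a vec" where
  "stack_vecs p n v = vec (p * n) (\<lambda>i. v (i div n) $ (i mod n))"

definition sym_pos_def :: "nat \<Rightarrow> real mat \<Rightarrow> bool" where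
  "sym_pos_def n R \<longleftrightarrow> R \<in> carrier_mat n n \<and> transpose_mat R = R \<and>
     (\<forall>x \<in> carrier_vec n. x \<noteq> 0\<^sub>v n \<longrightarrow> 0 < x \<bullet> (R *\<^sub>v x))"

text \<open>\<open>Q\<close> is the inverse square root of \<open>R\<close>: for symmetric positive definite \<open>R\<close>, such a \<open>Q\<close> exists and
  is unique.\<close>

definition is_inv_sqrt :: "nat \<Rightarrow> real mat \<Rightarrow> real mat \<Rightarrow> bool" where
  "is_inv_sqrt n R Q \<longleftrightarrow> sym_pos_def n Q \<and> Q * Q = mat_inv R"

definition neutrally_stable :: "real mat \<Rightarrow> bool" where
  "neutrally_stable A \<longleftrightarrow>
     (\<forall>z. eigenvalue (cmat A) z \<longrightarrow> cmod z \<le> 1) \<and>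
     (\<forall>blocks. jordan_nf (cmat A) blocks \<longrightarrow>
        (\<forall>(s, z) \<in> set blocks. cmod z = 1 \<longrightarrow> s = 1))"

definition detectable :: "real mat \<Rightarrow> real mat \<Rightarrow> bool" where
  "detectable C A \<longleftrightarrow>
     (\<forall>x \<in> carrier_vec (dim_col A).
        (\<forall>k. (C * A ^\<^sub>m k) *\<^sub>v x = 0\<^sub>v (dim_row C)) \<longrightarrow>
        (\<lambda>k. vec_norm2 ((A ^\<^sub>m k) *\<^sub>v x)) \<longlonglongrightarrow> 0)"

definition stabilizable :: "real mat \<Rightarrow> real mat \<Rightarrow> bool" where
  "stabilizable A B \<longleftrightarrow> detectable (transpose_mat B) (transpose_mat A)"

definition mat_arcs :: "nat \<Rightarrow> real mat \<Rightarrow> (nat \<times> nat) set" where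
  "mat_arcs p \<Lambda> = {(i, j). i < p \<and> j < p \<and> \<Lambda> $$ (i, j) > 0}"

definition connected_graph :: "nat \<Rightarrow> (nat \<times> nat) set \<Rightarrow> bool" where
  "connected_graph p E \<longleftrightarrow> (\<exists>j < p. \<forall>i < p. (i, j) \<in> E\<^sup>*)"

definition connected_matrix :: "nat \<Rightarrow> real mat \<Rightarrow> bool" where
  "connected_matrix p \<Lambda> \<longleftrightarrow> \<Lambda> \<in> carrier_mat p p \<and>
     (\<forall>i < p. \<Lambda> $$ (i, i) > 0) \<and>
     (\<forall>i < p. \<forall>j < p. \<Lambda> $$ (i, j) \<ge> 0) \<and>
     (\<forall>i < p. (\<Sum>j < p. \<Lambda> $$ (i, j)) = 1) \<and>
     connected_graph p (mat_arcs p \<Lambda>)"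

text \<open>The number of eigenvalues of magnitude one, with algebraic multiplicity.\<close>

definition num_unit_eigenvalues :: "real mat \<Rightarrow> nat" where
  "num_unit_eigenvalues A =
     (\<Sum>z | eigenvalue (cmat A) z \<and> cmod z = 1. Polynomial.order z (char_poly (cmat A)))"

text \<open>\<open>constructed_gain n m A C L\<close>: some admissible sequence of choices in the construction,
  applied to the \<open>n \<times> n\<close> matrix \<open>A\<close> and the \<open>m \<times> n\<close> matrix \<open>C\<close>, produces \<open>L\<close>.\<close>

definition constructed_gain ::
    "nat \<Rightarrow> nat \<Rightarrow> real mat \<Rightarrow> real mat \<Rightarrow> real mat \<Rightarrow> bool" where
  "constructed_gain n m A C L \<longleftrightarrow>
     (let n1 = num_unit_eigenvalues A; n2 = n - n1 in
      if n1 = 0 then L = 0\<^sub>m n m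
      else (\<exists>U W F G R Q H.
        U \<in> carrier_mat n n1 \<and> W \<in> carrier_mat n n2 \<and>
        F \<in> carrier_mat n1 n1 \<and> G \<in> carrier_mat n2 n2 \<and>
        invertible_mat (append_cols U W) \<and>
        mat_inv (append_cols U W) * A * append_cols U W
          = four_block_mat F (0\<^sub>m n1 n2) (0\<^sub>m n2 n1) G \<and>
        (\<forall>z. eigenvalue (cmat F) z \<longrightarrow> cmod z = 1) \<and>
        vec_space.rank m (C * U) = m \<and>
        sym_pos_def n1 R \<and> transpose_mat F * R * F = R \<and>
        is_inv_sqrt n1 R Q \<and>
        H \<in> carrier_mat m n1 \<and>
        vec_space.col_space n1 (transpose_mat H)
          = vec_space.col_space n1 (Q * transpose_mat U * transpose_mat C) \<and>
        H * transpose_mat H = 1\<^sub>m m \<and>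
        L = U * F * Q * transpose_mat H * mat_inv (C * U * Q * transpose_mat H)))"

end

theory Submission
  imports Defs "Jordan_Normal_Form.Spectral_Radius"
begin

text \<open>The weighted average of the states evolves by \<open>A\<^sup>T\<close>, so it suffices that the error dynamics,
  a linear system on \<open>\<real>\<^bsup>pn\<^esup>\<close>, have no eigenvalue \<open>\<mu>\<close> with \<open>\<bar>\<mu>\<bar> \<ge> 1\<close>.  Suppose
  \<open>v\<^sub>1, \<dots>, v\<^sub>p\<close> form an eigenvector.  Put \<open>\<xi>\<^sub>i = U\<^sup>Tv\<^sub>i\<close> and \<open>Q = R\<^bsup>-1/2\<^esup>\<close>.  With the
  orthogonal projection \<open>P = H\<^sup>TH\<close> and \<open>w\<^sub>i = QF\<^sup>T\<xi>\<^sub>i\<close>, the definition of \<open>L\<close> turns the equation into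
  \<open>(I - P)w\<^sub>i + P \<Sum>\<^sub>j \<lambda>\<^sub>i\<^sub>j w\<^sub>j = \<mu>Q\<xi>\<^sub>i\<close>, where \<open>\<bar>w\<^sub>i\<bar> = \<bar>Q\<xi>\<^sub>i\<bar>\<close> because
  \<open>F\<^sup>TRF = R\<close>.  Hence \<open>\<bar>Pw\<^sub>i\<bar> \<le> \<bar>\<Sum>\<^sub>j \<lambda>\<^sub>i\<^sub>j Pw\<^sub>j\<bar>\<close> for all \<open>i\<close>, and strict convexity
  shows that \<open>\<bar>Pw\<^sub>i\<bar>\<close> is maximal at the root of the graph and that \<open>Pw\<close> is constant on the root and its
  successors.  Subtracting the root's value and
  repeating the argument gives \<open>Pw = 0\<close>; detectability then forces all \<open>\<xi>\<^sub>i\<close> to agree.  With the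
  coupling gone, the differences \<open>v\<^sub>i - v\<^sub>j\<close> are eigenvectors of \<open>A\<^sup>T\<close> killed by \<open>U\<^sup>T\<close>; they belong to
  the block \<open>G\<close>, which has no eigenvalue on the unit circle since \<open>F\<close> exhausts these by
  multiplicity.\<close>

section \<open>Powers of Schur stable matrices and block systems\<close>

lemma smult_mat_pow:
  fixes A :: "'a :: comm_ring_1 mat"
  assumes A: "A \<in> carrier_mat n n"
  shows "(c \<cdot>\<^sub>m A) ^\<^sub>m k = c ^ k \<cdot>\<^sub>m A ^\<^sub>m k"
proof (induction k)
  case 0
  show ?case using A by auto
next
  case (Suc k)
  have Ak: "A ^\<^sub>m k \<in> carrier_mat n n" using A by simp
  have "(c \<cdot>\<^sub>m A) ^\<^sub>m Suc k = (c ^ k \<cdot>\<^sub>m A ^\<^sub>m k) * (c \<cdot>\<^sub>m A)"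
    using Suc by simp
  also have "\<dots> = c ^ k \<cdot>\<^sub>m (A ^\<^sub>m k * (c \<cdot>\<^sub>m A))"
    by (rule mult_smult_assoc_mat[OF Ak smult_carrier_mat[OF A]])
  also have "A ^\<^sub>m k * (c \<cdot>\<^sub>m A) = c \<cdot>\<^sub>m (A ^\<^sub>m k * A)"
    by (rule mult_smult_distrib[OF Ak A])
  finally show ?case
    by (intro eq_matI) auto
qed

text \<open>A spectral radius below one bounds all powers of a matrix by a constant. Applied to
  \<open>A\<close> divided by some \<rho> strictly between its spectral radius and one, this bounds
  the entries of \<open>A ^\<^sub>m k\<close> by a constant times \<open>\<rho> ^ k\<close>, which
  gives the decay.\<close>

lemma mat_pow_mult_vec_tendsto_0:
  fixes A :: "complex mat"
  assumes A: "A \<in> carrier_mat n n"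
    and ev: "\<And>z. eigenvalue A z \<Longrightarrow> cmod z < 1"
    and v: "v \<in> carrier_vec n" and i: "i < n"
  shows "(\<lambda>k. (A ^\<^sub>m k *\<^sub>v v) $ i) \<longlonglongrightarrow> 0"
proof -
  have n: "n > 0" using i by simp
  \<comment> \<open>The midpoint of the spectral radius and one is positive even when
    \<open>A\<close> is nilpotent, so dividing by it is always possible.\<close>
  define \<rho> where "\<rho> = (1 + spectral_radius A) / 2"
  obtain z0 where z0: "eigenvalue A z0" "spectral_radius A = cmod z0"
    using spectral_radius_mem_max(1)[OF A n] by (auto simp: spectrum_def)
  have sr: "0 \<le> spectral_radius A" "spectral_radius A < 1"
    using z0 ev[OF z0(1)] by auto
  have \<rho>: "0 < \<rho>" "\<rho> < 1" "spectral_radius A < \<rho>"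
    using sr by (auto simp: \<rho>_def)
  define B where "B = complex_of_real (1 / \<rho>) \<cdot>\<^sub>m A"
  have B: "B \<in> carrier_mat n n" using A by (simp add: B_def)
  have AB: "A = complex_of_real \<rho> \<cdot>\<^sub>m B"
    using \<rho> A by (intro eq_matI) (auto simp: B_def)
  have evB: "cmod z < 1" if z: "eigenvalue B z" for z
  proof -
    obtain w where w: "w \<in> carrier_vec n" "w \<noteq> 0\<^sub>v n" "B *\<^sub>v w = z \<cdot>\<^sub>v w"
      using z B by (auto simp: eigenvalue_def eigenvector_def)
    have "A *\<^sub>v w = complex_of_real \<rho> \<cdot>\<^sub>v (B *\<^sub>v w)"
      unfolding AB using B w(1)
      by (intro eq_vecI) (auto simp: scalar_prod_def sum_distrib_left mult.assoc)
    also have "\<dots> = (complex_of_real \<rho> * z) \<cdot>\<^sub>v w"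
      unfolding w(3) by (simp add: smult_smult_assoc)
    finally have "eigenvalue A (complex_of_real \<rho> * z)"
      using w A by (auto simp: eigenvalue_def eigenvector_def)
    then have "cmod (complex_of_real \<rho> * z) \<in> norm ` spectrum A"
      by (auto simp: spectrum_def)
    from spectral_radius_mem_max(2)[OF A n this] have "\<rho> * cmod z \<le> spectral_radius A"
      using \<rho> by (simp add: norm_mult)
    with \<rho>(3) have "\<rho> * cmod z < \<rho> * 1" by linarith
    then show ?thesis using \<rho> by (simp only: mult_less_cancel_left_pos)
  qed
  have "spectral_radius B < 1"
    using spectral_radius_mem_max(1)[OF B n] evB by (auto simp: spectrum_def)
  from spectral_radius_jnf_norm_bound_less_1_upper_triangular[OF B this]
  obtain c where c: "\<And>k. norm_bound (B ^\<^sub>m k) c" by blast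
  have "(\<lambda>k. (A ^\<^sub>m k) $$ (i, j)) \<longlonglongrightarrow> 0" if j: "j < n" for j
  proof (rule tendsto_0_le[where K = 1])
    show "\<forall>\<^sub>F k in sequentially. norm ((A ^\<^sub>m k) $$ (i, j)) \<le> norm (\<rho> ^ k * c) * 1"
    proof (rule eventuallyI)
      fix k
      have Bk: "B ^\<^sub>m k \<in> carrier_mat n n" using B by simp
      have "(A ^\<^sub>m k) $$ (i, j) = complex_of_real \<rho> ^ k * (B ^\<^sub>m k) $$ (i, j)"
        unfolding AB smult_mat_pow[OF B] using B i j by simp
      moreover have "cmod ((B ^\<^sub>m k) $$ (i, j)) \<le> c"
        using c[of k] carrier_matD[OF Bk] i j unfolding norm_bound_def by metis
      ultimately have "norm ((A ^\<^sub>m k) $$ (i, j)) \<le> \<rho> ^ k * c"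
        using \<rho> by (simp add: norm_mult norm_power mult_left_mono)
      then show "norm ((A ^\<^sub>m k) $$ (i, j)) \<le> norm (\<rho> ^ k * c) * 1" by simp
    qed
    have "(\<lambda>k. \<rho> ^ k) \<longlonglongrightarrow> 0" using \<rho> by (intro LIMSEQ_realpow_zero) auto
    then show "(\<lambda>k. \<rho> ^ k * c) \<longlonglongrightarrow> 0" by (rule tendsto_mult_left_zero)
  qed
  then have "(\<lambda>k. \<Sum>j<n. (A ^\<^sub>m k) $$ (i, j) * v $ j) \<longlonglongrightarrow> 0"
    by (intro tendsto_null_sum tendsto_mult_left_zero) auto
  moreover have "(A ^\<^sub>m k *\<^sub>v v) $ i = (\<Sum>j<n. (A ^\<^sub>m k) $$ (i, j) * v $ j)" for k
  proof -
    have "A ^\<^sub>m k \<in> carrier_mat n n" using A by simp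
    then show ?thesis
      using A v i by (auto simp: scalar_prod_def atLeast0LessThan)
  qed
  ultimately show ?thesis by simp
qed

text \<open>The power \<open>A ^\<^sub>m Suc k\<close> takes its new factor on the right, while a
  step of a linear system applies it on the left.\<close>

lemma mult_pow_mat_commute:
  fixes A :: "'a :: semiring_1 mat"
  assumes A: "A \<in> carrier_mat n n"
  shows "A * A ^\<^sub>m k = A ^\<^sub>m k * A"
proof (induction k)
  case 0
  show ?case using A by simp
next
  case (Suc k)
  have "A * A ^\<^sub>m Suc k = (A * A ^\<^sub>m k) * A"
    unfolding pow_mat.simps by (rule assoc_mult_mat[OF A pow_carrier_mat[OF A] A, symmetric])
  also have "\<dots> = A ^\<^sub>m Suc k * A"
    unfolding Suc pow_mat.simps ..
  finally show ?case .
qed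

section \<open>Block systems as one linear system\<close>

lemma sum_lessThan_blocks:
  fixes f :: "nat \<Rightarrow> 'a :: comm_monoid_add"
  shows "(\<Sum>s<p * n. f s) = (\<Sum>i<p. \<Sum>a<n. f (i * n + a))"
proof -
  have "sum f {i * n..<i * n + n} = (\<Sum>a<n. f (i * n + a))" for i
    using sum.shift_bounds_nat_ivl[of f 0 "i * n" n] by (simp add: atLeast0LessThan add.commute)
  then show ?thesis by (simp flip: sum.nat_group)
qed

lemma block_index:
  fixes n :: nat
  assumes "i < p" "a < n"
  shows "i * n + a < p * n"
proof -
  have "i * n + a < Suc i * n" using assms by simp
  also have "\<dots> \<le> p * n" using assms by (intro mult_le_mono1) simp
  finally show ?thesis .
qed

text \<open>The blocks \<open>K i j\<close> form one complex matrix \<open>B\<close> of size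
  \<open>p * n\<close>. An eigenvector of \<open>B\<close>, cut into \<open>p\<close> pieces of
  length \<open>n\<close>, is a family \<open>v\<close> as in \<open>spec\<close>; so
  \<open>B\<close> has no eigenvalue of modulus at least one, and the stacked states
  \<open>B ^\<^sub>m k *\<^sub>v E 0\<close> tend to zero.\<close>

lemma block_system_tendsto_0:
  fixes K :: "nat \<Rightarrow> nat \<Rightarrow> real mat" and e :: "nat \<Rightarrow> nat \<Rightarrow> real vec"
  assumes K: "\<And>i j. i < p \<Longrightarrow> j < p \<Longrightarrow> K i j \<in> carrier_mat n n"
    and e: "\<And>i k. i < p \<Longrightarrow> e i k \<in> carrier_vec n"
    and step: "\<And>i k a. i < p \<Longrightarrow> a < n \<Longrightarrow>
      e i (Suc k) $ a = (\<Sum>j<p. (K i j *\<^sub>v e j k) $ a)"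
    and spec: "\<And>\<mu> v i. (\<And>j. j < p \<Longrightarrow> v j \<in> carrier_vec n) \<Longrightarrow>
      (\<And>i a. i < p \<Longrightarrow> a < n \<Longrightarrow> (\<Sum>j<p. (cmat (K i j) *\<^sub>v v j) $ a) = \<mu> * v i $ a) \<Longrightarrow>
      1 \<le> cmod \<mu> \<Longrightarrow> i < p \<Longrightarrow> v i = 0\<^sub>v n"
    and i: "i < p" and a: "a < n"
  shows "(\<lambda>k. e i k $ a) \<longlonglongrightarrow> 0"
proof -
  define B where "B = mat (p * n) (p * n)
    (\<lambda>(s, t). complex_of_real (K (s div n) (t div n) $$ (s mod n, t mod n)))"
  define E where "E k = vec (p * n) (\<lambda>s. complex_of_real (e (s div n) k $ (s mod n)))" for k
  have B: "B \<in> carrier_mat (p * n) (p * n)" by (simp add: B_def)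
  have E: "E k \<in> carrier_vec (p * n)" for k by (simp add: E_def)
  have Bw: "(B *\<^sub>v w) $ (i * n + a) = (\<Sum>j<p. (cmat (K i j) *\<^sub>v vec n (\<lambda>b. w $ (j * n + b))) $ a)"
    if w: "w \<in> carrier_vec (p * n)" and ia: "i < p" "a < n" for w i a
  proof -
    have "(B *\<^sub>v w) $ (i * n + a) = (\<Sum>t<p * n. B $$ (i * n + a, t) * w $ t)"
      using w B block_index[OF ia] by (simp add: scalar_prod_def atLeast0LessThan)
    also have "\<dots> = (\<Sum>j<p. \<Sum>b<n. B $$ (i * n + a, j * n + b) * w $ (j * n + b))"
      by (rule sum_lessThan_blocks)
    also have "\<dots> = (\<Sum>j<p. \<Sum>b<n. complex_of_real (K i j $$ (a, b)) * w $ (j * n + b))"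
      using ia block_index by (intro sum.cong refl) (auto simp: B_def)
    also have "\<dots> = (\<Sum>j<p. (cmat (K i j) *\<^sub>v vec n (\<lambda>b. w $ (j * n + b))) $ a)"
    proof (intro sum.cong refl)
      fix j assume "j \<in> {..<p}"
      then have "K i j \<in> carrier_mat n n" using K ia by auto
      then show "(\<Sum>b<n. complex_of_real (K i j $$ (a, b)) * w $ (j * n + b)) =
          (cmat (K i j) *\<^sub>v vec n (\<lambda>b. w $ (j * n + b))) $ a"
        using ia by (auto simp: scalar_prod_def atLeast0LessThan)
    qed
    finally show ?thesis .
  qed
  have split: "\<exists>i a. s = i * n + a \<and> i < p \<and> a < n" if "s < p * n" for s
  proof -
    have "n > 0" using that by (cases n) auto
    then show ?thesis
      using that by (intro exI[of _ "s div n"] exI[of _ "s mod n"]) (simp add: less_mult_imp_div_less)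
  qed
  have "E (Suc k) = B *\<^sub>v E k" for k
  proof (rule eq_vecI)
    fix s assume "s < dim_vec (B *\<^sub>v E k)"
    then have "s < p * n" using B by simp
    then obtain i a where s: "s = i * n + a" "i < p" "a < n" using split by blast
    have "E (Suc k) $ s = complex_of_real (e i (Suc k) $ a)"
      using s block_index by (simp add: E_def)
    also have "\<dots> = (\<Sum>j<p. complex_of_real ((K i j *\<^sub>v e j k) $ a))"
      using s by (simp add: step)
    also have "\<dots> = (\<Sum>j<p. (cmat (K i j) *\<^sub>v vec n (\<lambda>b. E k $ (j * n + b))) $ a)"
    proof (intro sum.cong refl)
      fix j assume j: "j \<in> {..<p}"
      then have Kij: "K i j \<in> carrier_mat n n" and ej: "e j k \<in> carrier_vec n" using K e s by auto
      have "vec n (\<lambda>b. E k $ (j * n + b)) = map_vec complex_of_real (e j k)"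
        using j ej block_index by (intro eq_vecI) (auto simp: E_def)
      moreover have "map_vec complex_of_real (K i j *\<^sub>v e j k) = cmat (K i j) *\<^sub>v map_vec complex_of_real (e j k)"
        by (rule of_real_hom.mult_mat_vec_hom[OF Kij ej])
      moreover have "complex_of_real ((K i j *\<^sub>v e j k) $ a) = map_vec complex_of_real (K i j *\<^sub>v e j k) $ a"
        using Kij s by simp
      ultimately show "complex_of_real ((K i j *\<^sub>v e j k) $ a) =
          (cmat (K i j) *\<^sub>v vec n (\<lambda>b. E k $ (j * n + b))) $ a"
        by simp
    qed
    also have "\<dots> = (B *\<^sub>v E k) $ s" using Bw[OF E s(2,3)] s by simp
    finally show "E (Suc k) $ s = (B *\<^sub>v E k) $ s" .
  qed (use B in \<open>simp add: E_def\<close>)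
  then have pow: "E k = B ^\<^sub>m k *\<^sub>v E 0" for k
  proof (induction k)
    case 0
    then show ?case using B E[of 0] by simp
  next
    case (Suc k)
    have "B ^\<^sub>m Suc k *\<^sub>v E 0 = (B * B ^\<^sub>m k) *\<^sub>v E 0" using mult_pow_mat_commute[OF B] by simp
    also have "\<dots> = B *\<^sub>v (B ^\<^sub>m k *\<^sub>v E 0)"
      by (rule assoc_mult_mat_vec[OF B pow_carrier_mat[OF B] E])
    finally show ?case using Suc by simp
  qed
  have "cmod \<mu> < 1" if \<mu>: "eigenvalue B \<mu>" for \<mu>
  proof (rule ccontr)
    assume "\<not> cmod \<mu> < 1"
    then have large: "1 \<le> cmod \<mu>" by simp
    obtain w where w: "w \<in> carrier_vec (p * n)" "w \<noteq> 0\<^sub>v (p * n)" "B *\<^sub>v w = \<mu> \<cdot>\<^sub>v w"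
      using \<mu> B by (auto simp: eigenvalue_def eigenvector_def)
    have "vec n (\<lambda>b. w $ (i * n + b)) = 0\<^sub>v n" if "i < p" for i
    proof (rule spec[of "\<lambda>j. vec n (\<lambda>b. w $ (j * n + b))" \<mu>, OF _ _ large that])
      fix i a assume ia: "i < p" "a < n"
      show "(\<Sum>j<p. (cmat (K i j) *\<^sub>v vec n (\<lambda>b. w $ (j * n + b))) $ a) = \<mu> * vec n (\<lambda>b. w $ (i * n + b)) $ a"
        using Bw[OF w(1) ia] ia w block_index[OF ia] by simp
    qed simp
    then have "w $ (i * n + a) = 0" if "i < p" "a < n" for i a
      using that by (metis index_vec index_zero_vec(1))
    then have "w = 0\<^sub>v (p * n)" using w(1) split by (intro eq_vecI) fastforce+
    with w(2) show False by simp
  qed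
  from mat_pow_mult_vec_tendsto_0[OF B this E[of 0] block_index[OF i a]]
  have "(\<lambda>k. E k $ (i * n + a)) \<longlonglongrightarrow> 0"
    by (simp only: pow[symmetric])
  moreover have "E k $ (i * n + a) = complex_of_real (e i k $ a)" for k
    using i a block_index by (simp add: E_def)
  ultimately have "(\<lambda>k. complex_of_real (e i k $ a)) \<longlonglongrightarrow> complex_of_real 0" by simp
  then show ?thesis by (simp only: tendsto_of_real_iff)
qed

section \<open>Weighted averages over a connected graph\<close>

text \<open>The square of the Euclidean norm, whereas \<open>vec_norm2\<close> is the norm itself.
  Without the root, the identities for variances and projections are polynomial.\<close>

definition cvec_norm2 :: "complex vec \<Rightarrow> real" where
  "cvec_norm2 v = (\<Sum>a<dim_vec v. (cmod (v $ a))\<^sup>2)"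

text \<open>The dimension \<open>n\<close> is explicit and the sum is entrywise, so the result has
  dimension \<open>n\<close> whatever \<open>p\<close> and \<open>v\<close> are. Real weights serve
  the trajectories, complex ones the modes.\<close>

definition weighted_sum ::
    "nat \<Rightarrow> nat \<Rightarrow> (nat \<Rightarrow> 'a :: comm_ring_1) \<Rightarrow> (nat \<Rightarrow> 'a vec) \<Rightarrow> 'a vec" where
  "weighted_sum n p c v = vec n (\<lambda>a. \<Sum>j<p. c j * v j $ a)"

lemma weighted_sum_carrier [simp]: "weighted_sum n p c v \<in> carrier_vec n"
  by (simp add: weighted_sum_def)

lemma cvec_norm2_eq_0: "cvec_norm2 v = 0 \<longleftrightarrow> v = 0\<^sub>v (dim_vec v)"
  by (auto simp: cvec_norm2_def sum_nonneg_eq_0_iff vec_eq_iff)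

text \<open>Variance is mean square minus squared mean, the quantitative form of strict convexity.
  As the weights are real, the identity splits into real and imaginary parts.\<close>

lemma weighted_variance:
  fixes c :: "nat \<Rightarrow> real" and z :: "nat \<Rightarrow> complex"
  assumes "(\<Sum>j<p. c j) = 1"
  defines "m \<equiv> \<Sum>j<p. complex_of_real (c j) * z j"
  shows "(\<Sum>j<p. c j * (cmod (z j - m))\<^sup>2) = (\<Sum>j<p. c j * (cmod (z j))\<^sup>2) - (cmod m)\<^sup>2"
proof -
  have real: "(\<Sum>j<p. c j * (x j - \<mu>)\<^sup>2) = (\<Sum>j<p. c j * (x j)\<^sup>2) - \<mu>\<^sup>2"
    if \<mu>: "\<mu> = (\<Sum>j<p. c j * x j)" for x :: "nat \<Rightarrow> real" and \<mu>
  proof -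
    have "(\<Sum>j<p. c j * (x j - \<mu>)\<^sup>2) = (\<Sum>j<p. c j * (x j)\<^sup>2 - 2 * \<mu> * (c j * x j) + \<mu>\<^sup>2 * c j)"
      by (intro sum.cong) (auto simp: power2_eq_square algebra_simps)
    also have "\<dots> = (\<Sum>j<p. c j * (x j)\<^sup>2) - 2 * \<mu> * (\<Sum>j<p. c j * x j) + \<mu>\<^sup>2 * (\<Sum>j<p. c j)"
      by (simp add: sum.distrib sum_subtractf sum_distrib_left)
    finally show ?thesis using assms(1) \<mu> by (simp add: power2_eq_square)
  qed
  have "Re m = (\<Sum>j<p. c j * Re (z j))" "Im m = (\<Sum>j<p. c j * Im (z j))"
    by (simp_all add: m_def)
  from real[OF this(1)] real[OF this(2)] show ?thesis
    by (simp add: cmod_power2 distrib_left sum.distrib)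
qed

text \<open>A node of maximal norm can only have norm at most that of its weighted average when all its
  successors carry the same value; following arcs, the maximum reaches the root.\<close>

lemma consensus_at_root:
  fixes h :: "nat \<Rightarrow> complex vec"
  assumes conn: "connected_matrix p \<Lambda>"
    and q: "q < p" "\<And>i. i < p \<Longrightarrow> (i, q) \<in> (mat_arcs p \<Lambda>)\<^sup>*"
    and h: "\<And>i. i < p \<Longrightarrow> h i \<in> carrier_vec m"
    and le: "\<And>i. i < p \<Longrightarrow>
      cvec_norm2 (h i) \<le> cvec_norm2 (weighted_sum m p (\<lambda>j. complex_of_real (\<Lambda> $$ (i, j))) h)"
  shows "\<And>i. i < p \<Longrightarrow> cvec_norm2 (h i) \<le> cvec_norm2 (h q)"
    and "weighted_sum m p (\<lambda>j. complex_of_real (\<Lambda> $$ (q, j))) h = h q"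
proof -
  define M where "M = Max ((\<lambda>i. cvec_norm2 (h i)) ` {..<p})"
  have M: "cvec_norm2 (h i) \<le> M" if "i < p" for i
    unfolding M_def using that by (intro Max_ge) auto
  have "M \<in> (\<lambda>i. cvec_norm2 (h i)) ` {..<p}"
    unfolding M_def using q(1) by (intro Max_in) auto
  then obtain i0 where i0: "i0 < p" "cvec_norm2 (h i0) = M" by auto
  let ?s = "\<lambda>i. weighted_sum m p (\<lambda>j. complex_of_real (\<Lambda> $$ (i, j))) h"
  have eq_average: "h j = ?s i" if i: "i < p" "cvec_norm2 (h i) = M" and j: "j < p" "\<Lambda> $$ (i, j) > 0" for i j
  proof -
    let ?c = "\<lambda>j. \<Lambda> $$ (i, j)"
    have c: "(\<Sum>j<p. ?c j) = 1" "\<And>j. j < p \<Longrightarrow> ?c j \<ge> 0"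
      using conn i by (auto simp: connected_matrix_def)
    \<comment> \<open>\<open>D j\<close> is the squared distance of \<open>h j\<close> from the
      average at \<open>i\<close>. Its weighted sum is a variance, at most \<open>M - M = 0\<close>
      because \<open>i\<close> has maximal norm and its average has no smaller norm; so
      \<open>D j\<close> vanishes wherever the weight is positive.\<close>
    define D where "D j = (\<Sum>a<m. (cmod (h j $ a - ?s i $ a))\<^sup>2)" for j
    have "(\<Sum>j<p. ?c j * D j) = (\<Sum>a<m. \<Sum>j<p. ?c j * (cmod (h j $ a - ?s i $ a))\<^sup>2)"
      unfolding D_def sum_distrib_left by (rule sum.swap)
    also have "\<dots> = (\<Sum>a<m. (\<Sum>j<p. ?c j * (cmod (h j $ a))\<^sup>2) - (cmod (?s i $ a))\<^sup>2)"
      by (intro sum.cong refl) (simp add: weighted_sum_def weighted_variance[OF c(1)])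
    also have "\<dots> = (\<Sum>j<p. ?c j * (\<Sum>a<m. (cmod (h j $ a))\<^sup>2)) - (\<Sum>a<m. (cmod (?s i $ a))\<^sup>2)"
      unfolding sum_subtractf sum_distrib_left by (subst sum.swap) simp
    also have "\<dots> = (\<Sum>j<p. ?c j * cvec_norm2 (h j)) - cvec_norm2 (?s i)"
      using carrier_vecD[OF h] by (auto simp: cvec_norm2_def weighted_sum_def intro!: sum.cong)
    also have "\<dots> \<le> (\<Sum>j<p. ?c j * M) - M"
      using le[OF i(1)] i(2) M c by (intro diff_mono sum_mono mult_left_mono) auto
    also have "\<dots> = 0" using c(1) by (simp flip: sum_distrib_right)
    finally have "(\<Sum>j<p. ?c j * D j) \<le> 0" .
    moreover have D: "D j \<ge> 0" for j unfolding D_def by (intro sum_nonneg) auto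
    ultimately have "(\<Sum>j<p. ?c j * D j) = 0"
      using c by (intro antisym sum_nonneg mult_nonneg_nonneg) auto
    then have "\<forall>j\<in>{..<p}. ?c j * D j = 0"
      using c D by (subst (asm) sum_nonneg_eq_0_iff) auto
    then have "?c j * D j = 0" using j(1) by blast
    then have "D j = 0" using j by simp
    then show ?thesis
      using h[OF j(1)] by (intro eq_vecI) (auto simp: D_def sum_nonneg_eq_0_iff weighted_sum_def)
  qed
  have diag: "\<Lambda> $$ (i, i) > 0" if "i < p" for i using conn that by (auto simp: connected_matrix_def)
  from q(2)[OF i0(1)] have "cvec_norm2 (h q) = M"
  proof (induction rule: rtrancl_induct)
    case base
    show ?case by (rule i0(2))
  next
    case (step i j)
    then have "i < p" "j < p" "\<Lambda> $$ (i, j) > 0" by (auto simp: mat_arcs_def)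
    \<comment> \<open>The positive diagonal makes \<open>i\<close> its own successor, so
      \<open>h i\<close> and \<open>h j\<close> both equal the average at \<open>i\<close>.\<close>
    with eq_average[of i j] eq_average[of i i] diag[of i] step.IH show ?case by simp
  qed
  then show "\<And>i. i < p \<Longrightarrow> cvec_norm2 (h i) \<le> cvec_norm2 (h q)" "?s q = h q"
    using M eq_average[of q q] diag q(1) by auto
qed

section \<open>Full rank and eigenvalue counting\<close>

text \<open>A maximal independent set of columns has \<open>m\<close> elements by the rank
  hypothesis, hence is a basis of the whole space.\<close>

lemma full_rank_col_space:
  fixes B :: "'a :: field mat"
  assumes B: "B \<in> carrier_mat m nc" and rank: "vec_space.rank m B = m"
  shows "vec_space.col_space m B = carrier_vec m"
proof -
  interpret vec_space "TYPE('a)" m .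
  have cols: "set (cols B) \<subseteq> carrier_vec m" using B cols_dim by blast
  obtain S where S: "maximal S (\<lambda>T. T \<subseteq> set (cols B) \<and> lin_indpt T)" "finite S"
    using maximal_exists_superset[of "set (cols B)" "\<lambda>T. T \<subseteq> set (cols B) \<and> lin_indpt T" "{}"]
    by (auto simp: lin_dep_def)
  have SB: "S \<subseteq> set (cols B)" "lin_indpt S" using S(1) by (auto simp: maximal_def)
  have "card S = m" using rank_card_indpt[OF B S(1)] rank by simp
  then have "basis S"
    using dim_li_is_basis[of S] SB cols S(2) dim_is_n by auto
  then have "span S = carrier_vec m" by (simp add: basis_def)
  moreover have "span S \<subseteq> span (set (cols B))" using SB by (rule_tac span_is_monotone) auto
  moreover have "span (set (cols B)) \<subseteq> carrier_vec m" using cols by auto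
  ultimately show ?thesis unfolding col_space_def by auto
qed

text \<open>Full row rank gives \<open>x = B *\<^sub>v y\<close> for some \<open>y\<close>, so
  \<open>x \<bullet> x\<close> is the product of \<open>transpose_mat B *\<^sub>v x\<close> with
  \<open>y\<close>, which is zero.\<close>

lemma full_rank_left_kernel:
  fixes B :: "real mat"
  assumes B: "B \<in> carrier_mat m nc" and rank: "vec_space.rank m B = m"
    and x: "x \<in> carrier_vec m" and 0: "transpose_mat B *\<^sub>v x = 0\<^sub>v nc"
  shows "x = 0\<^sub>v m"
proof -
  have "x \<in> vec_space.col_space m B" using full_rank_col_space[OF B rank] x by simp
  then obtain y where y: "y \<in> carrier_vec nc" "B *\<^sub>v y = x"
    using vec_space.col_space_eq[OF B] B by auto
  have "x \<bullet> x = x \<bullet> (B *\<^sub>v y)" using y by simp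
  also have "\<dots> = (transpose_mat B *\<^sub>v x) \<bullet> y"
    using transpose_vec_mult_scalar[OF B y(1) x] B x y
    by (simp add: comm_scalar_prod[of _ m] comm_scalar_prod[of _ nc])
  also have "\<dots> = 0" using 0 y by simp
  finally show ?thesis using x
    by (intro eq_vecI) (auto simp: scalar_prod_def sum_nonneg_eq_0_iff)
qed

section \<open>Eigenvalues on the unit circle, counted with multiplicity\<close>

lemma sum_order_roots_eq_degree:
  fixes q :: "complex poly"
  assumes q: "q \<noteq> 0" and Z: "finite Z" "{z. poly q z = 0} \<subseteq> Z"
  shows "(\<Sum>z\<in>Z. Polynomial.order z q) = degree q"
proof -
  have "degree q = (\<Sum>z\<in>{z. poly q z = 0}. Polynomial.order z q)"
    using q by (simp flip: size_proots_complex add: size_multiset_overloaded_eq)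
  also have "\<dots> = (\<Sum>z\<in>Z. Polynomial.order z q)"
    using Z q by (intro sum.mono_neutral_left) (auto simp: order_root)
  finally show ?thesis by simp
qed

text \<open>The characteristic polynomial of \<open>A\<close> is the product of those of
  \<open>F\<close> and \<open>G\<close>. All \<open>n1\<close> roots of the first lie on the unit
  circle, and \<open>A\<close> has exactly \<open>n1\<close> such roots with multiplicity, so none
  remain for \<open>G\<close>.\<close>

lemma complement_block_no_unit_eigenvalue:
  fixes A :: "real mat"
  assumes A: "A \<in> carrier_mat n n" and F: "F \<in> carrier_mat n1 n1" and G: "G \<in> carrier_mat n2 n2"
    and T: "T \<in> carrier_mat n n" and S: "S \<in> carrier_mat n n" and n: "n = n1 + n2"
    and inv: "T * S = 1\<^sub>m n" "S * T = 1\<^sub>m n"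
    and block: "S * A * T = four_block_mat F (0\<^sub>m n1 n2) (0\<^sub>m n2 n1) G"
    and unit: "\<And>z. eigenvalue (cmat F) z \<Longrightarrow> cmod z = 1"
    and n1: "n1 = num_unit_eigenvalues A"
    and z: "eigenvalue (cmat G) z"
  shows "cmod z \<noteq> 1"
proof
  assume z1: "cmod z = 1"
  let ?B = "four_block_mat F (0\<^sub>m n1 n2) (0\<^sub>m n2 n1) G"
  have cF: "cmat F \<in> carrier_mat n1 n1" and cG: "cmat G \<in> carrier_mat n2 n2"
    and cA: "cmat A \<in> carrier_mat n n" using F G A by auto
  have "similar_mat ?B A"
    using T S A inv block F G n by (intro similar_matI[of _ _ S T n]) auto
  then have "char_poly A = char_poly ?B" by (rule char_poly_similar[symmetric])
  then have "char_poly (cmat A) = char_poly (cmat ?B)"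
    using A F G n of_real_hom.char_poly_hom[of A n] of_real_hom.char_poly_hom[of ?B n]
    by (metis four_block_carrier_mat)
  also have "cmat ?B = four_block_mat (cmat F) (0\<^sub>m n1 n2) (0\<^sub>m n2 n1) (cmat G)"
    using F G by (intro eq_matI) auto
  also have "char_poly \<dots> = char_poly (cmat F) * char_poly (cmat G)"
    using char_poly_factorized[OF cF] char_poly_factorized[OF cG]
    by (intro char_poly_0_block[OF refl _ _ cF _ cG]) auto
  finally have cp: "char_poly (cmat A) = char_poly (cmat F) * char_poly (cmat G)" .
  define Z where "Z = {z. eigenvalue (cmat A) z \<and> cmod z = 1}"
  have nz: "char_poly (cmat X) \<noteq> 0" if "X \<in> carrier_mat k k" for X :: "real mat" and k
    using degree_monic_char_poly[of "cmat X" k] that by auto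
  have fin: "finite Z"
    by (rule finite_subset[OF _ poly_roots_finite[OF nz[OF A]]])
      (auto simp: Z_def eigenvalue_root_char_poly[OF cA])
  have "{z. poly (char_poly (cmat F)) z = 0} \<subseteq> Z"
    using unit by (auto simp: Z_def eigenvalue_root_char_poly[OF cA] eigenvalue_root_char_poly[OF cF] cp)
  then have "(\<Sum>z\<in>Z. Polynomial.order z (char_poly (cmat F))) = n1"
    using sum_order_roots_eq_degree[OF nz[OF F] fin] degree_monic_char_poly[OF cF] by simp
  moreover have "n1 = (\<Sum>z\<in>Z. Polynomial.order z (char_poly (cmat F)))
      + (\<Sum>z\<in>Z. Polynomial.order z (char_poly (cmat G)))"
    using nz[OF A] unfolding n1 num_unit_eigenvalues_def Z_def[symmetric] cp
    by (simp add: order_mult sum.distrib)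
  ultimately have "(\<Sum>z\<in>Z. Polynomial.order z (char_poly (cmat G))) = 0" by linarith
  moreover have "z \<in> Z" "poly (char_poly (cmat G)) z = 0"
    using z z1 by (auto simp: Z_def eigenvalue_root_char_poly[OF cA] eigenvalue_root_char_poly[OF cG] cp)
  ultimately show False using fin nz[OF G] by (simp add: order_root)
qed

lemma num_unit_eigenvalues_0:
  assumes A: "A \<in> carrier_mat n n" and 0: "num_unit_eigenvalues A = 0"
    and z: "eigenvalue (cmat A) z"
  shows "cmod z \<noteq> 1"
proof
  assume z1: "cmod z = 1"
  have cA: "cmat A \<in> carrier_mat n n" using A by auto
  have nz: "char_poly (cmat A) \<noteq> 0"
    using degree_monic_char_poly[OF cA] by auto
  \<comment> \<open>Finiteness matters: a sum over an infinite set would be zero by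
    convention.\<close>
  have "finite {z. eigenvalue (cmat A) z \<and> cmod z = 1}"
    by (rule finite_subset[OF _ poly_roots_finite[OF nz]]) 
      (auto simp: eigenvalue_root_char_poly[OF cA])
  with 0 z z1 have "Polynomial.order z (char_poly (cmat A)) = 0"
    by (simp add: num_unit_eigenvalues_def)
  with z nz show False by (simp add: eigenvalue_root_char_poly[OF cA] order_root)
qed

lemma eigenvalue_transpose:
  fixes A :: "'a :: field mat"
  assumes "A \<in> carrier_mat n n"
  shows "eigenvalue (transpose_mat A) = eigenvalue A"
  using assms by (intro ext) (simp add: eigenvalue_root_char_poly[of _ n])

section \<open>The constructed gain\<close>

lemma det_nonzero_mat_inverse:
  fixes A :: "'a :: field mat"
  assumes A: "A \<in> carrier_mat n n" and det: "det A \<noteq> 0"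
  shows "mat_inv A \<in> carrier_mat n n" "A * mat_inv A = 1\<^sub>m n" "mat_inv A * A = 1\<^sub>m n"
proof -
  \<comment> \<open>\<open>mat_inv\<close> applies \<open>the\<close> to an option; the nonzero
    determinant rules out \<open>None\<close>.\<close>
  have "A \<in> Units (ring_mat TYPE('a) n ())" by (rule det_non_zero_imp_unit[OF A det])
  then obtain B where "mat_inverse A = Some B" using mat_inverse(1)[OF A, of "()"] by blast
  then show "mat_inv A \<in> carrier_mat n n" "A * mat_inv A = 1\<^sub>m n" "mat_inv A * A = 1\<^sub>m n"
    using mat_inverse(2)[OF A] by auto
qed

lemma det_nonzeroI:
  fixes A :: "'a :: field mat"
  assumes A: "A \<in> carrier_mat n n"
    and ker: "\<And>v. v \<in> carrier_vec n \<Longrightarrow> A *\<^sub>v v = 0\<^sub>v n \<Longrightarrow> v = 0\<^sub>v n"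
  shows "det A \<noteq> 0"
  using ker det_0_iff_vec_prod_zero_field[OF A] by blast

lemma sym_pos_def_det_nonzero:
  assumes "sym_pos_def n R"
  shows "det R \<noteq> 0"
proof (rule det_nonzeroI)
  show R: "R \<in> carrier_mat n n" using assms by (simp add: sym_pos_def_def)
  show "v = 0\<^sub>v n" if v: "v \<in> carrier_vec n" "R *\<^sub>v v = 0\<^sub>v n" for v
  proof (rule ccontr)
    assume "v \<noteq> 0\<^sub>v n"
    then have "0 < v \<bullet> (R *\<^sub>v v)" using assms v by (auto simp: sym_pos_def_def)
    then show False using v by simp
  qed
qed

lemma invertible_mat_det_nonzero:
  fixes T :: "'a :: field mat"
  assumes "invertible_mat T" and T: "T \<in> carrier_mat n n"
  shows "det T \<noteq> 0"
proof -
  obtain B where B: "T * B = 1\<^sub>m n" "B * T = 1\<^sub>m (dim_row B)"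
    using assms by (auto simp: invertible_mat_def inverts_mat_def)
  \<comment> \<open>Nothing is known of the size of \<open>B\<close> beforehand; it is read off from
    the identity matrices on the right.\<close>
  have "dim_col (T * B) = n" "dim_col (B * T) = dim_row B" using B by simp_all
  then have "B \<in> carrier_mat n n" using T by auto
  then have "det T * det B = 1" using det_mult[OF T, of B] B(1) by simp
  then show ?thesis by auto
qed

text \<open>By invariance of \<open>R\<close>, the product of \<open>S\<close>,
  \<open>transpose_mat F\<close> and \<open>R\<close> is a left inverse of \<open>F\<close>, hence
  also a right inverse; cancelling \<open>R\<close> leaves the invariance of \<open>S\<close> under
  the transpose.\<close>

lemma inverse_quadratic_form_invariant:
  fixes F R S :: "'a :: field mat"
  assumes F: "F \<in> carrier_mat n n" and R: "R \<in> carrier_mat n n" and S: "S \<in> carrier_mat n n"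
    and inv: "R * S = 1\<^sub>m n" "S * R = 1\<^sub>m n"
    and FRF: "transpose_mat F * R * F = R"
  shows "F * S * transpose_mat F = S"
proof -
  have Ft: "transpose_mat F \<in> carrier_mat n n" using F by simp
  have X: "S * (transpose_mat F * R) \<in> carrier_mat n n" using S Ft R by simp
  have "(S * (transpose_mat F * R)) * F = S * (transpose_mat F * R * F)"
    using S Ft R F by (simp add: assoc_mult_mat[of _ n n _ n _ n])
  then have "(S * (transpose_mat F * R)) * F = 1\<^sub>m n" using FRF inv by simp
  then have "F * (S * (transpose_mat F * R)) = 1\<^sub>m n"
    by (rule mat_mult_left_right_inverse[OF X F])
  then have "(F * (S * (transpose_mat F * R))) * S = S" using S by simp
  moreover have "(F * (S * (transpose_mat F * R))) * S = F * S * transpose_mat F * (R * S)"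
    using F S Ft R by (simp add: assoc_mult_mat[of _ n n _ n _ n])
  ultimately show ?thesis using inv F S Ft by simp
qed

text \<open>As \<open>H\<close> has orthonormal rows, \<open>transpose_mat H * H\<close> is the
  orthogonal projection onto the column space of \<open>transpose_mat H\<close>, which contains
  every column of \<open>Y\<close>.\<close>

lemma projection_onto_col_space:
  fixes H Y :: "real mat"
  assumes H: "H \<in> carrier_mat m k" and Y: "Y \<in> carrier_mat k l" and HH: "H * transpose_mat H = 1\<^sub>m m"
    and range: "vec_space.col_space k (transpose_mat H) = vec_space.col_space k Y"
  shows "transpose_mat H * (H * Y) = Y"
proof (rule mat_col_eqI)
  have Ht: "transpose_mat H \<in> carrier_mat k m" using H by simp
  fix j assume "j < dim_col Y"
  then have j: "j < l" using Y by simp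
  have "col Y j = Y *\<^sub>v unit_vec l j"
    using Y j by (intro eq_vecI) (auto simp: scalar_prod_right_unit)
  then have "col Y j \<in> vec_space.col_space k Y"
    unfolding vec_space.col_space_eq[OF Y] using Y by auto
  then obtain x where x: "x \<in> carrier_vec m" "transpose_mat H *\<^sub>v x = col Y j"
    unfolding range[symmetric] vec_space.col_space_eq[OF Ht] using H by auto
  have "H *\<^sub>v col Y j = (H * transpose_mat H) *\<^sub>v x"
    using x H by (simp add: assoc_mult_mat_vec[OF H Ht])
  then have "H *\<^sub>v col Y j = x" using HH x by simp
  moreover have "col (transpose_mat H * (H * Y)) j = transpose_mat H *\<^sub>v (H *\<^sub>v col Y j)"
    using H Y j by (simp add: col_mult2[OF Ht mult_carrier_mat[OF H Y] j] col_mult2[OF H Y j])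
  ultimately show "col (transpose_mat H * (H * Y)) j = col Y j" using x by simp
qed (use H Y in auto)

text \<open>The last claim holds because a vector annihilated by \<open>U\<^sup>T\<close> lies in the complementary invariant subspace of \<open>A\<^sup>T\<close>, on which \<open>A\<^sup>T\<close>
  acts as \<open>G\<^sup>T\<close>.\<close>

lemma modal_decomposition:
  fixes A :: "real mat"
  assumes A: "A \<in> carrier_mat n n" and n1: "n1 = num_unit_eigenvalues A"
    and U: "U \<in> carrier_mat n n1" and W: "W \<in> carrier_mat n n2"
    and F: "F \<in> carrier_mat n1 n1" and G: "G \<in> carrier_mat n2 n2"
    and inv: "invertible_mat (append_cols U W)"
    and block: "mat_inv (append_cols U W) * A * append_cols U W
          = four_block_mat F (0\<^sub>m n1 n2) (0\<^sub>m n2 n1) G"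
    and unit: "\<And>z. eigenvalue (cmat F) z \<Longrightarrow> cmod z = 1"
  shows "A * U = U * F"
    and "\<exists>U'. U' \<in> carrier_mat n1 n \<and> U' * U = 1\<^sub>m n1"
    and "\<And>v z. v \<in> carrier_vec n \<Longrightarrow> cmat (transpose_mat A) *\<^sub>v v = z \<cdot>\<^sub>v v \<Longrightarrow>
           cmat (transpose_mat U) *\<^sub>v v = 0\<^sub>v n1 \<Longrightarrow> cmod z = 1 \<Longrightarrow> v = 0\<^sub>v n"
proof -
  define T where "T = append_cols U W"
  have "T \<in> carrier_mat n (n1 + n2)" 
    using U W by (intro carrier_matI) (auto simp: T_def append_cols_def)
  \<comment> \<open>Invertibility makes \<open>T\<close> square, which yields
    \<open>n = n1 + n2\<close>. In the construction \<open>n2\<close> is the truncated difference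
    \<open>n - n1\<close>, so this also excludes \<open>n1 > n\<close>.\<close>
  moreover have "square_mat T" using inv by (simp add: T_def invertible_mat_def)
  ultimately have n: "n = n1 + n2" and T: "T \<in> carrier_mat n n" by auto
  define S where "S = mat_inv T"
  have "det T \<noteq> 0" using invertible_mat_det_nonzero[OF _ T] inv by (simp add: T_def)
  from det_nonzero_mat_inverse[OF T this]
  have S: "S \<in> carrier_mat n n" and TS: "T * S = 1\<^sub>m n" and ST: "S * T = 1\<^sub>m n"
    by (simp_all add: S_def)
  let ?B = "four_block_mat F (0\<^sub>m n1 n2) (0\<^sub>m n2 n1) G"
  have B: "?B \<in> carrier_mat n n" using F G n by simp
  have SAT: "S * A * T = ?B" using block by (simp add: S_def T_def)
  have "T * ?B = T * (S * A * T)" by (simp only: SAT)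
  also have "\<dots> = (T * S) * (A * T)"
    using T S A by (simp add: assoc_mult_mat[of _ n n _ n _ n])
  finally have AT: "A * T = T * ?B" using TS A T by simp
  \<comment> \<open>\<open>J\<close> and \<open>J'\<close> are the coordinate embeddings that pick
    the first \<open>n1\<close> and the last \<open>n2\<close> columns of \<open>T\<close>, that is,
    \<open>U\<close> and \<open>W\<close>.\<close>
  define J where "J = mat n n1 (\<lambda>(i, j). if i = j then 1 else 0 :: real)"
  define J' where "J' = mat n n2 (\<lambda>(i, j). if i = j + n1 then 1 else 0 :: real)"
  have J: "J \<in> carrier_mat n n1" and J': "J' \<in> carrier_mat n n2" by (simp_all add: J_def J'_def)
  have mJ: "(M * J) $$ (i, j) = M $$ (i, j)" if "M \<in> carrier_mat k n" "i < k" "j < n1" for M k i j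
    using that n by (simp add: J_def scalar_prod_def if_distrib sum.delta cong: if_cong)
  have mJ': "(M * J') $$ (i, j) = M $$ (i, j + n1)" if "M \<in> carrier_mat k n" "i < k" "j < n2" for M k i j
    using that n by (simp add: J'_def scalar_prod_def if_distrib sum.delta cong: if_cong)
  have UJ: "U = T * J"
    using U W n mJ[OF T] T J by (intro eq_matI) (auto simp: T_def append_cols_def)
  have WJ: "W = T * J'"
    using U W n mJ'[OF T] T J' by (intro eq_matI) (auto simp: T_def append_cols_def)
  have BJ: "?B * J = J * F"
  proof (rule eq_matI)
    fix i j assume "i < dim_row (J * F)" "j < dim_col (J * F)"
    then have ij: "i < n" "j < n1" using J F by auto
    have "(J * F) $$ (i, j) = (\<Sum>k<n1. (if i = k then 1 else 0) * F $$ (k, j))"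
      using ij F by (simp add: J_def scalar_prod_def atLeast0LessThan)
    also have "\<dots> = (\<Sum>k<n1. if k = i then F $$ (i, j) else 0)"
      by (intro sum.cong) auto
    finally show "(?B * J) $$ (i, j) = (J * F) $$ (i, j)"
      using mJ[OF B ij] ij F G n by auto
  qed (use B J F in auto)
  have BJ': "?B * J' = J' * G"
  proof (rule eq_matI)
    fix i j assume "i < dim_row (J' * G)" "j < dim_col (J' * G)"
    then have ij: "i < n" "j < n2" using J' G by auto
    have "(J' * G) $$ (i, j) = (\<Sum>k<n2. (if i = k + n1 then 1 else 0) * G $$ (k, j))"
      using ij G by (simp add: J'_def scalar_prod_def atLeast0LessThan)
    also have "\<dots> = (\<Sum>k<n2. if k + n1 = i then G $$ (k, j) else 0)"
      by (intro sum.cong) auto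
    also have "\<dots> = (if i < n1 then 0 else G $$ (i - n1, j))"
    proof (cases "i < n1")
      case False
      then have "(\<Sum>k<n2. if k + n1 = i then G $$ (k, j) else 0) = (\<Sum>k<n2. if k = i - n1 then G $$ (k, j) else 0)"
        by (intro sum.cong) auto
      then show ?thesis using False ij n by simp
    qed (auto intro!: sum.neutral)
    finally show "(?B * J') $$ (i, j) = (J' * G) $$ (i, j)"
      using mJ'[OF B ij] ij F G n by auto
  qed (use B J' G in auto)
  have "A * U = T * (?B * J)"
    unfolding UJ assoc_mult_mat[OF A T J, symmetric] AT by (rule assoc_mult_mat[OF T B J])
  then show AU: "A * U = U * F"
    unfolding BJ UJ using T J F by (simp add: assoc_mult_mat[of _ n n _ n1 _ n1])
  have "A * W = T * (?B * J')"
    unfolding WJ assoc_mult_mat[OF A T J', symmetric] AT by (rule assoc_mult_mat[OF T B J'])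
  then have AW: "A * W = W * G"
    unfolding BJ' WJ using T J' G by (simp add: assoc_mult_mat[of _ n n _ n2 _ n2])
  have JJ: "transpose_mat J * J = 1\<^sub>m n1"
    using mJ[of "transpose_mat J" n1] n J by (intro eq_matI) (auto simp: J_def)
  have "(transpose_mat J * S) * U = transpose_mat J * ((S * T) * J)"
    unfolding UJ using J S T
    by (simp add: assoc_mult_mat[of _ n1 n _ n _ n1] assoc_mult_mat[of _ n n _ n _ n1])
  then have "(transpose_mat J * S) * U = 1\<^sub>m n1" using ST J JJ by simp
  then show "\<exists>U'. U' \<in> carrier_mat n1 n \<and> U' * U = 1\<^sub>m n1"
    using J S by (intro exI[of _ "transpose_mat J * S"]) simp
  fix v z
  assume v: "v \<in> carrier_vec n" and Av: "cmat (transpose_mat A) *\<^sub>v v = z \<cdot>\<^sub>v v"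
    and Uv: "cmat (transpose_mat U) *\<^sub>v v = 0\<^sub>v n1" and z: "cmod z = 1"
  \<comment> \<open>Transposing \<open>A * W = W * G\<close> shows that this vector, unless it is
    zero, is an eigenvector of \<open>transpose_mat G\<close> for \<open>z\<close>.\<close>
  let ?g = "cmat (transpose_mat W) *\<^sub>v v"
  have cW: "cmat (transpose_mat W) \<in> carrier_mat n2 n" and cA: "cmat (transpose_mat A) \<in> carrier_mat n n"
    and cG: "cmat (transpose_mat G) \<in> carrier_mat n2 n2" using W A G by auto
  have g: "?g \<in> carrier_vec n2" using cW v by simp
  have "cmat (transpose_mat G) *\<^sub>v ?g = (cmat (transpose_mat G) * cmat (transpose_mat W)) *\<^sub>v v"
    by (rule assoc_mult_mat_vec[symmetric, OF cG cW v])
  also have "cmat (transpose_mat G) * cmat (transpose_mat W) = cmat (transpose_mat (W * G))"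
    unfolding transpose_mult[OF W G]
    by (rule of_real_hom.mat_hom_mult[symmetric]) (use W G in auto)
  also have "\<dots> = cmat (transpose_mat W) * cmat (transpose_mat A)"
    unfolding AW[symmetric] transpose_mult[OF A W]
    by (rule of_real_hom.mat_hom_mult) (use W A in auto)
  also have "\<dots> *\<^sub>v v = cmat (transpose_mat W) *\<^sub>v (z \<cdot>\<^sub>v v)"
    unfolding Av[symmetric] by (rule assoc_mult_mat_vec[OF cW cA v])
  also have "\<dots> = z \<cdot>\<^sub>v ?g" by (rule mult_mat_vec[OF cW v])
  finally have ev: "cmat (transpose_mat G) *\<^sub>v ?g = z \<cdot>\<^sub>v ?g" .
  have g0: "?g = 0\<^sub>v n2"
  proof (rule ccontr)
    assume "?g \<noteq> 0\<^sub>v n2"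
    then have "eigenvalue (cmat (transpose_mat G)) z"
      using ev g cG by (auto simp: eigenvalue_def eigenvector_def)
    then have "eigenvalue (cmat G) z"
      using eigenvalue_transpose[of "cmat G" n2] G by (simp add: map_mat_transpose)
    from complement_block_no_unit_eigenvalue[OF A F G T S n TS ST SAT unit n1 this] z
    show False by simp
  qed
  have cT: "cmat (transpose_mat T) \<in> carrier_mat n n" and cS: "cmat (transpose_mat S) \<in> carrier_mat n n"
    using T S by auto
  \<comment> \<open>The product stacks the images of \<open>v\<close> under the transposes of
    \<open>U\<close> and \<open>W\<close>, both zero; the invertibility of \<open>T\<close> then
    gives \<open>v = 0\<^sub>v n\<close>.\<close>
  have "cmat (transpose_mat T) *\<^sub>v v = 0\<^sub>v n"
  proof (rule eq_vecI)
    fix i assume "i < dim_vec (0\<^sub>v n :: complex vec)"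
    then have i: "i < n" by simp
    show "(cmat (transpose_mat T) *\<^sub>v v) $ i = 0\<^sub>v n $ i"
    proof (cases "i < n1")
      case True
      then have "(cmat (transpose_mat T) *\<^sub>v v) $ i = (cmat (transpose_mat U) *\<^sub>v v) $ i"
        using T U W v i by (auto simp: scalar_prod_def T_def append_cols_def intro!: sum.cong)
      then show ?thesis using Uv True i by simp
    next
      case False
      then have "(cmat (transpose_mat T) *\<^sub>v v) $ i = ?g $ (i - n1)"
        using T U W v i n by (auto simp: scalar_prod_def T_def append_cols_def intro!: sum.cong)
      then show ?thesis using g0 False i n by simp
    qed
  qed (use T in simp)
  then have "cmat (transpose_mat S) *\<^sub>v (cmat (transpose_mat T) *\<^sub>v v) = 0\<^sub>v n"
    using S by (auto intro!: eq_vecI)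
  moreover have "cmat (transpose_mat S) * cmat (transpose_mat T) = 1\<^sub>m n"
  proof -
    have "cmat (transpose_mat S) * cmat (transpose_mat T) = cmat (transpose_mat (T * S))"
      unfolding transpose_mult[OF T S]
      by (rule of_real_hom.mat_hom_mult[symmetric]) (use T S in auto)
    then show ?thesis by (simp add: TS of_real_hom.mat_hom_one)
  qed
  ultimately show "v = 0\<^sub>v n" using assoc_mult_mat_vec[OF cS cT v] v by simp
qed

text \<open>Collects what the later arguments need of the construction. Write \<open>Y\<close> for
  \<open>Q U\<^sup>T C\<^sup>T\<close> and \<open>N\<close> for the matrix inverted in
  \<open>L\<close>. The projection \<open>H\<^sup>T H\<close> fixes \<open>Y\<close>, so
  \<open>Y = H\<^sup>T N\<^sup>T\<close>; hence \<open>C U Q = N H\<close>, and the inverse of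
  \<open>N\<close> in \<open>L\<close> cancels in \<open>Y L\<^sup>T\<close>. The factorization
  \<open>L = U X\<close> shows that \<open>L\<^sup>T\<close> kills whatever \<open>U\<^sup>T\<close>
  kills.\<close>

lemma constructed_gain_data:
  assumes A: "A \<in> carrier_mat n n" and C: "C \<in> carrier_mat m n"
    and gain: "constructed_gain n m A C L"
    and n1: "n1 = num_unit_eigenvalues A" "n1 \<noteq> 0"
  obtains U U' F Q Q' H N where
    "U \<in> carrier_mat n n1" "U' \<in> carrier_mat n1 n" "U' * U = 1\<^sub>m n1"
    "F \<in> carrier_mat n1 n1" "A * U = U * F"
    "Q \<in> carrier_mat n1 n1" "Q' \<in> carrier_mat n1 n1" "Q' * Q = 1\<^sub>m n1" "transpose_mat Q = Q"
    "F * (Q * Q) * transpose_mat F = Q * Q"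
    "H \<in> carrier_mat m n1" "H * transpose_mat H = 1\<^sub>m m"
    "N \<in> carrier_mat m m" "C * (U * Q) = N * H"
    "L \<in> carrier_mat n m"
    "(Q * (transpose_mat U * transpose_mat C)) * transpose_mat L =
       transpose_mat H * (H * (Q * (transpose_mat F * transpose_mat U)))"
    "\<And>v z. v \<in> carrier_vec n \<Longrightarrow> cmat (transpose_mat A) *\<^sub>v v = z \<cdot>\<^sub>v v \<Longrightarrow>
       cmat (transpose_mat U) *\<^sub>v v = 0\<^sub>v n1 \<Longrightarrow> cmod z = 1 \<Longrightarrow> v = 0\<^sub>v n"
    "\<exists>X \<in> carrier_mat n1 m. L = U * X"
proof -
  from gain n1 obtain U W F G R Q H where
    U: "U \<in> carrier_mat n n1" and W: "W \<in> carrier_mat n (n - n1)" and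
    F: "F \<in> carrier_mat n1 n1" and G: "G \<in> carrier_mat (n - n1) (n - n1)" and
    inv: "invertible_mat (append_cols U W)" and
    block: "mat_inv (append_cols U W) * A * append_cols U W
      = four_block_mat F (0\<^sub>m n1 (n - n1)) (0\<^sub>m (n - n1) n1) G" and
    unit: "\<And>z. eigenvalue (cmat F) z \<Longrightarrow> cmod z = 1" and
    rank: "vec_space.rank m (C * U) = m" and
    R: "sym_pos_def n1 R" and FRF: "transpose_mat F * R * F = R" and
    QR: "is_inv_sqrt n1 R Q" and H: "H \<in> carrier_mat m n1" and
    range: "vec_space.col_space n1 (transpose_mat H)
      = vec_space.col_space n1 (Q * transpose_mat U * transpose_mat C)" and
    HH: "H * transpose_mat H = 1\<^sub>m m" and
    L: "L = U * F * Q * transpose_mat H * mat_inv (C * U * Q * transpose_mat H)"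
    unfolding constructed_gain_def Let_def by (simp split: if_splits) blast
  note modal = modal_decomposition[OF A n1(1) U W F G inv block unit]
  obtain U' where U': "U' \<in> carrier_mat n1 n" "U' * U = 1\<^sub>m n1" using modal(2) by blast
  have Q: "Q \<in> carrier_mat n1 n1" "transpose_mat Q = Q" and QQ: "Q * Q = mat_inv R"
    and Qpd: "sym_pos_def n1 Q"
    using QR by (auto simp: is_inv_sqrt_def sym_pos_def_def)
  define Q' where "Q' = mat_inv Q"
  have Q': "Q' \<in> carrier_mat n1 n1" "Q' * Q = 1\<^sub>m n1"
    using det_nonzero_mat_inverse[OF Q(1) sym_pos_def_det_nonzero[OF Qpd]] by (auto simp: Q'_def)
  have Rc: "R \<in> carrier_mat n1 n1" using R by (simp add: sym_pos_def_def)
  note Rinv = det_nonzero_mat_inverse[OF Rc sym_pos_def_det_nonzero[OF R]]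
  have FQF: "F * (Q * Q) * transpose_mat F = Q * Q"
    unfolding QQ by (rule inverse_quadratic_form_invariant[OF F Rc Rinv FRF])
  have Ut: "transpose_mat U \<in> carrier_mat n1 n" and Ct: "transpose_mat C \<in> carrier_mat n m"
    and Ft: "transpose_mat F \<in> carrier_mat n1 n1" and Ht: "transpose_mat H \<in> carrier_mat n1 m"
    using U C F H by auto
  define Y where "Y = Q * (transpose_mat U * transpose_mat C)"
  have Y: "Y \<in> carrier_mat n1 m" using Q Ut Ct by (auto simp: Y_def)
  have Y_alt: "Q * transpose_mat U * transpose_mat C = Y"
    unfolding Y_def by (rule assoc_mult_mat[OF Q(1) Ut Ct])
  have HHY: "transpose_mat H * (H * Y) = Y"
    using projection_onto_col_space[OF H Y HH] range Y_alt by simp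
  have CU: "C * U \<in> carrier_mat m n1" using C U by simp
  have Yt: "transpose_mat Y = C * U * Q"
    unfolding Y_def transpose_mult[OF Q(1) mult_carrier_mat[OF Ut Ct]] transpose_mult[OF Ut Ct]
    using Q by simp
  define N where "N = C * U * Q * transpose_mat H"
  have N: "N \<in> carrier_mat m m" unfolding N_def using CU Q Ht by auto
  have Nt: "transpose_mat N = H * Y"
    unfolding N_def Yt[symmetric] using transpose_mult[of "transpose_mat Y" m n1 "transpose_mat H" m] Y Ht
    by simp
  \<comment> \<open>If \<open>N\<^sup>T x = 0\<close>, then
    \<open>Y x = H\<^sup>T N\<^sup>T x = 0\<close>. The factor \<open>Q\<close> is invertible, and
    the full row rank of \<open>C * U\<close> then gives \<open>x = 0\<close>.\<close>
  have "det (transpose_mat N) \<noteq> 0"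
  proof (rule det_nonzeroI)
    show "transpose_mat N \<in> carrier_mat m m" using N by simp
    fix x assume x: "x \<in> carrier_vec m" and 0: "transpose_mat N *\<^sub>v x = 0\<^sub>v m"
    have "Y *\<^sub>v x = transpose_mat H *\<^sub>v (transpose_mat N *\<^sub>v x)"
      unfolding Nt using assoc_mult_mat_vec[OF Ht mult_carrier_mat[OF H Y] x] HHY by simp
    also have "\<dots> = 0\<^sub>v n1" unfolding 0 using Ht by (intro eq_vecI) auto
    finally have Yx: "Y *\<^sub>v x = 0\<^sub>v n1" .
    have UCt: "transpose_mat U * transpose_mat C \<in> carrier_mat n1 m" using Ut Ct by simp
    have "transpose_mat (C * U) *\<^sub>v x = (Q' * Q) *\<^sub>v ((transpose_mat U * transpose_mat C) *\<^sub>v x)"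
      unfolding Q'(2) transpose_mult[OF C U] using UCt x by simp
    also have "\<dots> = Q' *\<^sub>v (Q *\<^sub>v ((transpose_mat U * transpose_mat C) *\<^sub>v x))"
      by (rule assoc_mult_mat_vec[OF Q'(1) Q(1)]) (use UCt x in simp)
    also have "Q *\<^sub>v ((transpose_mat U * transpose_mat C) *\<^sub>v x) = Y *\<^sub>v x"
      unfolding Y_def by (rule assoc_mult_mat_vec[OF Q(1) UCt x, symmetric])
    also have "Q' *\<^sub>v (Y *\<^sub>v x) = 0\<^sub>v n1" unfolding Yx using Q' by (intro eq_vecI) auto
    finally show "x = 0\<^sub>v m" by (rule full_rank_left_kernel[OF CU rank x])
  qed
  then have "det N \<noteq> 0" using det_transpose[OF N] by simp
  note Ninv = det_nonzero_mat_inverse[OF N this]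
  have "N * H = transpose_mat (transpose_mat H * (H * Y))"
    using transpose_mult[OF Ht mult_carrier_mat[OF H Y]] Nt by (metis transpose_transpose)
  then have "N * H = C * U * Q" unfolding HHY Yt by simp
  then have NH: "C * (U * Q) = N * H" using assoc_mult_mat[OF C U Q(1)] by simp
  have UFQ: "U * F * Q \<in> carrier_mat n n1" and UFQH: "U * F * Q * transpose_mat H \<in> carrier_mat n m"
    using U F Q Ht by auto
  have Lc: "L \<in> carrier_mat n m" unfolding L N_def[symmetric] using UFQH Ninv by auto
  let ?E = "H * (Q * (transpose_mat F * transpose_mat U))"
  have E: "?E \<in> carrier_mat m n" using H Q Ft Ut by auto
  have Nit: "transpose_mat (mat_inv N) \<in> carrier_mat m m" and Ntc: "transpose_mat N \<in> carrier_mat m m"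
    using N Ninv by auto
  have "transpose_mat L = transpose_mat (mat_inv N) * ?E"
    unfolding L N_def[symmetric] transpose_mult[OF UFQH Ninv(1)] transpose_mult[OF UFQ Ht]
      transpose_mult[OF mult_carrier_mat[OF U F] Q(1)] transpose_mult[OF U F] Q(2)
    by simp
  then have "Y * transpose_mat L = (transpose_mat H * transpose_mat N) * (transpose_mat (mat_inv N) * ?E)"
    unfolding Nt HHY by simp
  also have "\<dots> = transpose_mat H * (transpose_mat N * (transpose_mat (mat_inv N) * ?E))"
    by (rule assoc_mult_mat[OF Ht Ntc mult_carrier_mat[OF Nit E]])
  also have "transpose_mat N * (transpose_mat (mat_inv N) * ?E) = (transpose_mat N * transpose_mat (mat_inv N)) * ?E"
    by (rule assoc_mult_mat[OF Ntc Nit E, symmetric])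
  also have "transpose_mat N * transpose_mat (mat_inv N) = 1\<^sub>m m"
    unfolding transpose_mult[OF Ninv(1) N, symmetric] Ninv(3) by simp
  also have "1\<^sub>m m * ?E = ?E" by (rule left_mult_one_mat[OF E])
  finally have YL: "(Q * (transpose_mat U * transpose_mat C)) * transpose_mat L = transpose_mat H * ?E"
    unfolding Y_def .
  have "L = U * (F * Q * transpose_mat H * mat_inv N)"
    unfolding L N_def[symmetric] using U F Q Ht Ninv
    by (simp add: assoc_mult_mat[of _ _ n1 _ n1 _ n1] assoc_mult_mat[of _ _ n1 _ n1 _ m]
        assoc_mult_mat[of _ _ n1 _ m _ m])
  then have LU: "\<exists>X \<in> carrier_mat n1 m. L = U * X"
    using F Q Ht Ninv by (intro bexI[of _ "F * Q * transpose_mat H * mat_inv N"]) auto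
  show thesis
    by (rule that[OF U U' F modal(1) Q(1) Q' Q(2) FQF H HH N NH Lc YL modal(3) LU])
qed

section \<open>Unstable modes\<close>

lemma map_vec_Re_Im_mult:
  assumes "M \<in> carrier_mat nr nc" "v \<in> carrier_vec nc"
  shows "map_vec Re (cmat M *\<^sub>v v) = M *\<^sub>v map_vec Re v"
    and "map_vec Im (cmat M *\<^sub>v v) = M *\<^sub>v map_vec Im v"
  using assms by (auto intro!: eq_vecI simp: scalar_prod_def)

lemma map_vec_add_diff:
  fixes f :: "'a :: group_add \<Rightarrow> 'b :: group_add"
  assumes "v \<in> carrier_vec n" "w \<in> carrier_vec n" and "\<And>x y. f (x + y) = f x + f y"
    and "\<And>x y. f (x - y) = f x - f y"
  shows "map_vec f (v + w) = map_vec f v + map_vec f w"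
    and "map_vec f (v - w) = map_vec f v - map_vec f w"
  using assms by (auto intro!: eq_vecI)

lemma cvec_norm2_Re_Im:
  "cvec_norm2 v = map_vec Re v \<bullet> map_vec Re v + map_vec Im v \<bullet> map_vec Im v"
  by (simp add: cvec_norm2_def scalar_prod_def cmod_power2 sum.distrib atLeast0LessThan
      flip: power2_eq_square)

lemma cvec_norm2_smult: "cvec_norm2 (c \<cdot>\<^sub>v v) = (cmod c)\<^sup>2 * cvec_norm2 v"
  by (simp add: cvec_norm2_def norm_mult power_mult_distrib sum_distrib_left)

lemma cvec_norm2_nonneg: "0 \<le> cvec_norm2 v"
  by (auto simp: cvec_norm2_def intro: sum_nonneg)

text \<open>The norm of a real matrix times a vector depends on the matrix only through its Gram
  matrix.\<close>

lemma cvec_norm2_isometry: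
  assumes M: "M \<in> carrier_mat a n" and M': "M' \<in> carrier_mat b n"
    and eq: "transpose_mat M * M = transpose_mat M' * M'" and v: "v \<in> carrier_vec n"
  shows "cvec_norm2 (cmat M *\<^sub>v v) = cvec_norm2 (cmat M' *\<^sub>v v)"
proof -
  have "(X *\<^sub>v x) \<bullet> (X *\<^sub>v x) = ((transpose_mat X * X) *\<^sub>v x) \<bullet> x"
    if X: "X \<in> carrier_mat k n" and x: "x \<in> carrier_vec n" for X :: "real mat" and x k
  proof -
    have "transpose_mat X \<in> carrier_mat n k" using X by simp
    then show ?thesis
      using transpose_vec_mult_scalar[OF X x, of "X *\<^sub>v x"] X x assoc_mult_mat_vec[of "transpose_mat X" n k X n x]
      by simp
  qed
  from this[OF M] this[OF M'] show ?thesis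
    using v by (simp add: cvec_norm2_Re_Im map_vec_Re_Im_mult[OF M v] map_vec_Re_Im_mult[OF M' v] eq)
qed

text \<open>With the orthogonal projection \<open>P = H\<^sup>T H\<close>, the vector on the left is
  \<open>(I - P) w + H\<^sup>T g\<close>. The summands are orthogonal, and \<open>H\<^sup>T\<close>
  preserves norms because \<open>H H\<^sup>T\<close> is the identity.\<close>

lemma cvec_norm2_replace_projection:
  assumes H: "H \<in> carrier_mat m n" and HH: "H * transpose_mat H = 1\<^sub>m m"
    and w: "w \<in> carrier_vec n" and g: "g \<in> carrier_vec m"
  shows "cvec_norm2 (w + cmat (transpose_mat H) *\<^sub>v (g - cmat H *\<^sub>v w))
    = cvec_norm2 w - cvec_norm2 (cmat H *\<^sub>v w) + cvec_norm2 g"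
proof -
  have Ht: "transpose_mat H \<in> carrier_mat n m" using H by simp
  have real: "(x + transpose_mat H *\<^sub>v (y - H *\<^sub>v x)) \<bullet> (x + transpose_mat H *\<^sub>v (y - H *\<^sub>v x))
      = x \<bullet> x - (H *\<^sub>v x) \<bullet> (H *\<^sub>v x) + y \<bullet> y"
    if x: "x \<in> carrier_vec n" and y: "y \<in> carrier_vec m" for x y
  proof -
    define h where "h = H *\<^sub>v x"
    define d where "d = y - h"
    have h: "h \<in> carrier_vec m" and d: "d \<in> carrier_vec m" using H x y by (auto simp: h_def d_def)
    define t where "t = transpose_mat H *\<^sub>v d"
    have t: "t \<in> carrier_vec n" using Ht d by (simp add: t_def)
    have "(x + t) \<bullet> (x + t) = x \<bullet> x + 2 * (t \<bullet> x) + t \<bullet> t"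
      using x t by (simp add: scalar_prod_add_distrib[of _ n] add_scalar_prod_distrib[of _ n] comm_scalar_prod[of x n t])
    moreover have "t \<bullet> x = d \<bullet> h"
      unfolding t_def h_def by (rule transpose_vec_mult_scalar[OF H x d])
    moreover have "t \<bullet> t = d \<bullet> d"
    proof -
      have "H *\<^sub>v t = d"
        unfolding t_def using assoc_mult_mat_vec[OF H Ht d] HH d by simp
      then show ?thesis using transpose_vec_mult_scalar[OF H t d] by (simp add: t_def)
    qed
    moreover have "d \<bullet> h = y \<bullet> h - h \<bullet> h"
      unfolding d_def by (rule minus_scalar_prod_distrib[OF y h h])
    moreover have "d \<bullet> d = y \<bullet> y - 2 * (y \<bullet> h) + h \<bullet> h"
      using y h d by (simp add: d_def scalar_prod_minus_distrib[of _ m] minus_scalar_prod_distrib[of _ m] comm_scalar_prod[of h m y])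
    ultimately show ?thesis by (simp add: t_def d_def h_def)
  qed
  have Hw: "cmat H *\<^sub>v w \<in> carrier_vec m" and d: "g - cmat H *\<^sub>v w \<in> carrier_vec m" and
    t: "cmat (transpose_mat H) *\<^sub>v (g - cmat H *\<^sub>v w) \<in> carrier_vec n"
    using H w g by auto
  have "map_vec Re (w + cmat (transpose_mat H) *\<^sub>v (g - cmat H *\<^sub>v w))
      = map_vec Re w + transpose_mat H *\<^sub>v (map_vec Re g - H *\<^sub>v map_vec Re w)"
    using map_vec_add_diff(1)[OF w t, of Re] map_vec_add_diff(2)[OF g Hw, of Re]
    by (simp add: map_vec_Re_Im_mult[OF Ht d] map_vec_Re_Im_mult[OF H w])
  moreover have "map_vec Im (w + cmat (transpose_mat H) *\<^sub>v (g - cmat H *\<^sub>v w))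
      = map_vec Im w + transpose_mat H *\<^sub>v (map_vec Im g - H *\<^sub>v map_vec Im w)"
    using map_vec_add_diff(1)[OF w t, of Im] map_vec_add_diff(2)[OF g Hw, of Im]
    by (simp add: map_vec_Re_Im_mult[OF Ht d] map_vec_Re_Im_mult[OF H w])
  ultimately show ?thesis
    using real[of "map_vec Re w" "map_vec Re g"] real[of "map_vec Im w" "map_vec Im g"] w g
    by (simp add: cvec_norm2_Re_Im map_vec_Re_Im_mult[OF H w])
qed

text \<open>The eigenvector form of detectability. The real and imaginary parts of \<open>y\<close>
  give zero output at all times, so detectability sends \<open>z ^ k \<cdot>\<^sub>v y\<close> to
  zero; yet its norm never falls below that of \<open>y\<close>.\<close>

lemma detectable_eigenvector:
  assumes det: "detectable C A" and A: "A \<in> carrier_mat n n" and C: "C \<in> carrier_mat m n"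
    and y: "y \<in> carrier_vec n" and ev: "cmat A *\<^sub>v y = z \<cdot>\<^sub>v y" and z: "1 \<le> cmod z"
    and Cy: "cmat C *\<^sub>v y = 0\<^sub>v m"
  shows "y = 0\<^sub>v n"
proof (rule ccontr)
  assume nz: "y \<noteq> 0\<^sub>v n"
  have cA: "cmat A \<in> carrier_mat n n" and cC: "cmat C \<in> carrier_mat m n" using A C by auto
  have pow: "cmat (A ^\<^sub>m k) *\<^sub>v y = z ^ k \<cdot>\<^sub>v y" for k
  proof -
    have "cmat (A ^\<^sub>m k) = cmat A ^\<^sub>m k" by (rule of_real_hom.mat_hom_pow[OF A])
    moreover have "cmat A ^\<^sub>m k *\<^sub>v y = z ^ k \<cdot>\<^sub>v y"
      by (rule eigenvector_pow[OF cA]) (use y nz ev A in \<open>simp add: eigenvector_def\<close>)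
    ultimately show ?thesis by simp
  qed
  have Ak: "A ^\<^sub>m k \<in> carrier_mat n n" for k using A by simp
  have Ck: "cmat C *\<^sub>v (z ^ k \<cdot>\<^sub>v y) = 0\<^sub>v m" for k
    unfolding mult_mat_vec[OF cC y] Cy by (intro eq_vecI) auto
  have Aky: "cmat (A ^\<^sub>m k) *\<^sub>v y \<in> carrier_vec n" for k unfolding pow using y by simp
  have "(\<lambda>k. vec_norm2 (A ^\<^sub>m k *\<^sub>v map_vec Re y)) \<longlonglongrightarrow> 0"
  proof (rule det[unfolded detectable_def, rule_format])
    fix k
    have "(C * A ^\<^sub>m k) *\<^sub>v map_vec Re y = C *\<^sub>v (A ^\<^sub>m k *\<^sub>v map_vec Re y)"
      by (rule assoc_mult_mat_vec[OF C Ak]) (use y in simp)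
    also have "\<dots> = map_vec Re (cmat C *\<^sub>v (cmat (A ^\<^sub>m k) *\<^sub>v y))"
      unfolding map_vec_Re_Im_mult(1)[OF C Aky] map_vec_Re_Im_mult(1)[OF Ak y] ..
    finally show "(C * A ^\<^sub>m k) *\<^sub>v map_vec Re y = 0\<^sub>v (dim_row C)"
      unfolding pow Ck using C by (auto intro!: eq_vecI)
  qed (use y A in auto)
  moreover have "(\<lambda>k. vec_norm2 (A ^\<^sub>m k *\<^sub>v map_vec Im y)) \<longlonglongrightarrow> 0"
  proof (rule det[unfolded detectable_def, rule_format])
    fix k
    have "(C * A ^\<^sub>m k) *\<^sub>v map_vec Im y = C *\<^sub>v (A ^\<^sub>m k *\<^sub>v map_vec Im y)"
      by (rule assoc_mult_mat_vec[OF C Ak]) (use y in simp)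
    also have "\<dots> = map_vec Im (cmat C *\<^sub>v (cmat (A ^\<^sub>m k) *\<^sub>v y))"
      unfolding map_vec_Re_Im_mult(2)[OF C Aky] map_vec_Re_Im_mult(2)[OF Ak y] ..
    finally show "(C * A ^\<^sub>m k) *\<^sub>v map_vec Im y = 0\<^sub>v (dim_row C)"
      unfolding pow Ck using C by (auto intro!: eq_vecI)
  qed (use y A in auto)
  ultimately have "(\<lambda>k. (vec_norm2 (A ^\<^sub>m k *\<^sub>v map_vec Re y))\<^sup>2
      + (vec_norm2 (A ^\<^sub>m k *\<^sub>v map_vec Im y))\<^sup>2) \<longlonglongrightarrow> 0\<^sup>2 + 0\<^sup>2"
    by (intro tendsto_intros)
  moreover have "(vec_norm2 x)\<^sup>2 = x \<bullet> x" for x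
    by (simp add: vec_norm2_def scalar_prod_def sum_nonneg)
  ultimately have "(\<lambda>k. cvec_norm2 (z ^ k \<cdot>\<^sub>v y)) \<longlonglongrightarrow> 0"
    unfolding pow[symmetric] cvec_norm2_Re_Im map_vec_Re_Im_mult[OF Ak y] by simp
  moreover have "cvec_norm2 y \<le> cvec_norm2 (z ^ k \<cdot>\<^sub>v y)" for k
    unfolding cvec_norm2_smult
    using mult_right_mono[of 1 "(cmod (z ^ k))\<^sup>2", OF _ cvec_norm2_nonneg[of y]] z
    by (simp add: norm_power one_le_power)
  ultimately have "cvec_norm2 y \<le> 0"
    by (intro LIMSEQ_le_const) auto
  with cvec_norm2_nonneg[of y] have "cvec_norm2 y = 0" by simp
  with y nz show False by (simp add: cvec_norm2_eq_0)
qed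

section \<open>Weighted sums and modes of the coupled system\<close>

lemma mult_mat_weighted_sum:
  assumes M: "M \<in> carrier_mat a n" and v: "\<And>j. j < p \<Longrightarrow> v j \<in> carrier_vec n"
  shows "M *\<^sub>v weighted_sum n p c v = weighted_sum a p c (\<lambda>j. M *\<^sub>v v j)"
proof (rule eq_vecI)
  fix i assume "i < dim_vec (weighted_sum a p c (\<lambda>j. M *\<^sub>v v j))"
  then have i: "i < a" by (simp add: weighted_sum_def)
  have "(M *\<^sub>v weighted_sum n p c v) $ i = (\<Sum>b<n. \<Sum>j<p. c j * (M $$ (i, b) * v j $ b))"
    using M i by (simp add: weighted_sum_def scalar_prod_def atLeast0LessThan sum_distrib_left mult_ac)
  also have "\<dots> = (\<Sum>j<p. c j * (\<Sum>b<n. M $$ (i, b) * v j $ b))"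
    unfolding sum_distrib_left by (rule sum.swap)
  also have "\<dots> = weighted_sum a p c (\<lambda>j. M *\<^sub>v v j) $ i"
    using M i carrier_vecD[OF v]
    by (auto simp: weighted_sum_def scalar_prod_def atLeast0LessThan intro!: sum.cong)
  finally show "(M *\<^sub>v weighted_sum n p c v) $ i = weighted_sum a p c (\<lambda>j. M *\<^sub>v v j) $ i" .
qed (use M in \<open>simp add: weighted_sum_def\<close>)

lemma weighted_sum_diff:
  assumes c: "(\<Sum>j<p. c j) = 1" and v: "\<And>j. j < p \<Longrightarrow> v j \<in> carrier_vec n" and w: "w \<in> carrier_vec n"
  shows "weighted_sum n p c (\<lambda>j. v j - w) = weighted_sum n p c v - w"
proof (rule eq_vecI)
  fix a assume "a < dim_vec (weighted_sum n p c v - w)"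
  then have a: "a < n" using w by simp
  have "(\<Sum>j<p. c j * (v j - w) $ a) = (\<Sum>j<p. c j * v j $ a - c j * w $ a)"
    using a w by (intro sum.cong) (auto simp: algebra_simps)
  also have "\<dots> = (\<Sum>j<p. c j * v j $ a) - w $ a"
    using c by (simp add: sum_subtractf flip: sum_distrib_right)
  finally show "weighted_sum n p c (\<lambda>j. v j - w) $ a = (weighted_sum n p c v - w) $ a"
    using a w by (simp add: weighted_sum_def)
qed (use w in \<open>simp add: weighted_sum_def\<close>)

lemma connected_matrix_root:
  assumes "connected_matrix p \<Lambda>"
  obtains q where "q < p" "\<And>i. i < p \<Longrightarrow> (i, q) \<in> (mat_arcs p \<Lambda>)\<^sup>*"
  using assms by (auto simp: connected_matrix_def connected_graph_def)

lemma connected_matrix_row_sum: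
  assumes "connected_matrix p \<Lambda>" "i < p"
  shows "(\<Sum>j<p. complex_of_real (\<Lambda> $$ (i, j))) = 1"
  using assms by (simp add: connected_matrix_def flip: of_real_sum)

text \<open>Since \<open>W\<close> and \<open>Q\<close> induce the same norm, the coupling cannot decrease the norm of the
  components \<open>H W \<xi>\<^sub>i\<close> when \<open>\<bar>\<mu>\<bar> \<ge> 1\<close>.\<close>

lemma unstable_mode_at_root:
  fixes \<xi> :: "nat \<Rightarrow> complex vec"
  assumes conn: "connected_matrix p \<Lambda>"
    and q: "q < p" "\<And>i. i < p \<Longrightarrow> (i, q) \<in> (mat_arcs p \<Lambda>)\<^sup>*"
    and W: "W \<in> carrier_mat n n" and Q: "Q \<in> carrier_mat n n"
    and WQ: "transpose_mat W * W = transpose_mat Q * Q"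
    and H: "H \<in> carrier_mat m n" and HH: "H * transpose_mat H = 1\<^sub>m m"
    and \<xi>: "\<And>i. i < p \<Longrightarrow> \<xi> i \<in> carrier_vec n"
    and \<mu>: "1 \<le> cmod \<mu>"
    and eq: "\<And>i. i < p \<Longrightarrow> cmat W *\<^sub>v \<xi> i + cmat (transpose_mat H) *\<^sub>v
      (weighted_sum m p (\<lambda>j. complex_of_real (\<Lambda> $$ (i, j))) (\<lambda>j. cmat H *\<^sub>v (cmat W *\<^sub>v \<xi> j))
        - cmat H *\<^sub>v (cmat W *\<^sub>v \<xi> i)) = \<mu> \<cdot>\<^sub>v (cmat Q *\<^sub>v \<xi> i)"
  shows "\<And>i. i < p \<Longrightarrow>
      cvec_norm2 (cmat H *\<^sub>v (cmat W *\<^sub>v \<xi> i)) \<le> cvec_norm2 (cmat H *\<^sub>v (cmat W *\<^sub>v \<xi> q))"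
    and "cmat W *\<^sub>v \<xi> q = \<mu> \<cdot>\<^sub>v (cmat Q *\<^sub>v \<xi> q)"
proof -
  let ?h = "\<lambda>i. cmat H *\<^sub>v (cmat W *\<^sub>v \<xi> i)"
  let ?g = "\<lambda>i. weighted_sum m p (\<lambda>j. complex_of_real (\<Lambda> $$ (i, j))) ?h"
  have w: "cmat W *\<^sub>v \<xi> i \<in> carrier_vec n" if "i < p" for i using W \<xi>[OF that] by simp
  have h: "?h i \<in> carrier_vec m" if "i < p" for i using H w[OF that] by simp
  have le: "cvec_norm2 (?h i) \<le> cvec_norm2 (?g i)" if i: "i < p" for i
  proof -
    have "(cmod \<mu>)\<^sup>2 * cvec_norm2 (cmat W *\<^sub>v \<xi> i) = cvec_norm2 (\<mu> \<cdot>\<^sub>v (cmat Q *\<^sub>v \<xi> i))"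
      by (simp add: cvec_norm2_smult cvec_norm2_isometry[OF W Q WQ \<xi>[OF i]])
    also have "\<dots> = cvec_norm2 (cmat W *\<^sub>v \<xi> i) - cvec_norm2 (?h i) + cvec_norm2 (?g i)"
      unfolding eq[OF i, symmetric]
      by (rule cvec_norm2_replace_projection[OF H HH w[OF i]]) simp
    finally have *: "(cmod \<mu>)\<^sup>2 * cvec_norm2 (cmat W *\<^sub>v \<xi> i)
      = cvec_norm2 (cmat W *\<^sub>v \<xi> i) - cvec_norm2 (?h i) + cvec_norm2 (?g i)" .
    have "1 * cvec_norm2 (cmat W *\<^sub>v \<xi> i) \<le> (cmod \<mu>)\<^sup>2 * cvec_norm2 (cmat W *\<^sub>v \<xi> i)"
      using \<mu> by (intro mult_right_mono cvec_norm2_nonneg) (simp add: one_le_power)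
    then show ?thesis using * by simp
  qed
  note root = consensus_at_root[OF conn q h le]
  then show "\<And>i. i < p \<Longrightarrow> cvec_norm2 (?h i) \<le> cvec_norm2 (?h q)" by blast
  \<comment> \<open>At the root the average is the node's own value, so the coupling term drops out
    of its equation.\<close>
  have "?g q - ?h q = 0\<^sub>v m" using root(2) h[OF q(1)] by simp
  moreover have "cmat (transpose_mat H) *\<^sub>v 0\<^sub>v m = 0\<^sub>v n" using H by (intro eq_vecI) auto
  ultimately show "cmat W *\<^sub>v \<xi> q = \<mu> \<cdot>\<^sub>v (cmat Q *\<^sub>v \<xi> q)"
    using eq[OF q(1)] w[OF q(1)] by simp
qed

lemma mat_mult_vec_zero:
  assumes "M \<in> carrier_mat a b"
  shows "M *\<^sub>v 0\<^sub>v b = (0\<^sub>v a :: 'a :: semiring_0 vec)"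
  using assms by (intro eq_vecI) auto

text \<open>The value at the root solves the uncoupled equation, so it may be subtracted from all nodes.
  The difference vanishes at the root, where the components \<open>H W \<xi>\<^sub>i\<close> have maximal norm.\<close>

lemma unstable_mode_synchronized:
  fixes \<xi> :: "nat \<Rightarrow> complex vec"
  assumes conn: "connected_matrix p \<Lambda>"
    and q: "q < p" "\<And>i. i < p \<Longrightarrow> (i, q) \<in> (mat_arcs p \<Lambda>)\<^sup>*"
    and W: "W \<in> carrier_mat n n" and Q: "Q \<in> carrier_mat n n"
    and WQ: "transpose_mat W * W = transpose_mat Q * Q"
    and H: "H \<in> carrier_mat m n" and HH: "H * transpose_mat H = 1\<^sub>m m"
    and \<xi>: "\<And>i. i < p \<Longrightarrow> \<xi> i \<in> carrier_vec n"
    and \<mu>: "1 \<le> cmod \<mu>"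
    and eq: "\<And>i. i < p \<Longrightarrow> cmat W *\<^sub>v \<xi> i + cmat (transpose_mat H) *\<^sub>v
      (weighted_sum m p (\<lambda>j. complex_of_real (\<Lambda> $$ (i, j))) (\<lambda>j. cmat H *\<^sub>v (cmat W *\<^sub>v \<xi> j))
        - cmat H *\<^sub>v (cmat W *\<^sub>v \<xi> i)) = \<mu> \<cdot>\<^sub>v (cmat Q *\<^sub>v \<xi> i)"
    and observable: "\<And>\<eta>. \<eta> \<in> carrier_vec n \<Longrightarrow> cmat W *\<^sub>v \<eta> = \<mu> \<cdot>\<^sub>v (cmat Q *\<^sub>v \<eta>) \<Longrightarrow>
      cmat H *\<^sub>v (cmat W *\<^sub>v \<eta>) = 0\<^sub>v m \<Longrightarrow> \<eta> = 0\<^sub>v n"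
    and i: "i < p"
  shows "\<xi> i = \<xi> q"
proof -
  define \<eta> where "\<eta> i = \<xi> i - \<xi> q" for i
  let ?hw = "\<lambda>v. cmat H *\<^sub>v (cmat W *\<^sub>v v)"
  let ?ws = "\<lambda>i v. weighted_sum m p (\<lambda>j. complex_of_real (\<Lambda> $$ (i, j))) v"
  have cW: "cmat W \<in> carrier_mat n n" and cQ: "cmat Q \<in> carrier_mat n n"
    and cH: "cmat H \<in> carrier_mat m n" and cHt: "cmat (transpose_mat H) \<in> carrier_mat n m"
    using W Q H by auto
  have \<xi>q: "\<xi> q \<in> carrier_vec n" using \<xi> q by simp
  have \<eta>: "\<eta> i \<in> carrier_vec n" if "i < p" for i using \<xi>[OF that] \<xi>q by (simp add: \<eta>_def)
  have W\<eta>: "cmat W *\<^sub>v \<eta> i = cmat W *\<^sub>v \<xi> i - cmat W *\<^sub>v \<xi> q" if "i < p" for i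
    unfolding \<eta>_def by (rule mult_minus_distrib_mat_vec[OF cW \<xi>[OF that] \<xi>q])
  have Wc: "cmat W *\<^sub>v \<xi> i \<in> carrier_vec n" if "i < p" for i using cW \<xi>[OF that] by simp
  have hw: "?hw (\<xi> i) \<in> carrier_vec m" if "i < p" for i using cH Wc[OF that] by simp
  have HW\<eta>: "?hw (\<eta> i) = ?hw (\<xi> i) - ?hw (\<xi> q)" if "i < p" for i
    unfolding W\<eta>[OF that] by (rule mult_minus_distrib_mat_vec[OF cH Wc[OF that] Wc[OF q(1)]])
  have Q\<eta>: "\<mu> \<cdot>\<^sub>v (cmat Q *\<^sub>v \<eta> i) = \<mu> \<cdot>\<^sub>v (cmat Q *\<^sub>v \<xi> i) - \<mu> \<cdot>\<^sub>v (cmat Q *\<^sub>v \<xi> q)" if "i < p" for i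
    unfolding \<eta>_def mult_minus_distrib_mat_vec[OF cQ \<xi>[OF that] \<xi>q]
    using cQ \<xi>[OF that] \<xi>q by (intro eq_vecI) (auto simp: algebra_simps)
  have root: "cmat W *\<^sub>v \<xi> q = \<mu> \<cdot>\<^sub>v (cmat Q *\<^sub>v \<xi> q)"
    by (rule unstable_mode_at_root(2)[OF conn q W Q WQ H HH \<xi> \<mu> eq])
  \<comment> \<open>Rows of \<Lambda> sum to one, so subtracting a common vector from all nodes
    leaves the coupling unchanged.\<close>
  have ws\<eta>: "?ws i (\<lambda>j. ?hw (\<eta> j)) - ?hw (\<eta> i) = ?ws i (\<lambda>j. ?hw (\<xi> j)) - ?hw (\<xi> i)"
    if i: "i < p" for i
  proof -
    have "?ws i (\<lambda>j. ?hw (\<eta> j)) = ?ws i (\<lambda>j. ?hw (\<xi> j) - ?hw (\<xi> q))"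
      using HW\<eta> by (simp add: weighted_sum_def)
    also have "\<dots> = ?ws i (\<lambda>j. ?hw (\<xi> j)) - ?hw (\<xi> q)"
      by (rule weighted_sum_diff[OF connected_matrix_row_sum[OF conn i] hw hw[OF q(1)]])
    finally show ?thesis
      unfolding HW\<eta>[OF i] using hw[OF i] hw[OF q(1)] weighted_sum_carrier[of m]
      by (intro eq_vecI) (auto simp del: weighted_sum_carrier simp: weighted_sum_def)
  qed
  have shift: "(x - y) + t = (x + t) - y"
    if "x \<in> carrier_vec n" "y \<in> carrier_vec n" "t \<in> carrier_vec n" for x y t :: "complex vec"
    using that by (intro eq_vecI) auto
  have eq\<eta>: "cmat W *\<^sub>v \<eta> i + cmat (transpose_mat H) *\<^sub>v (?ws i (\<lambda>j. ?hw (\<eta> j)) - ?hw (\<eta> i))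
      = \<mu> \<cdot>\<^sub>v (cmat Q *\<^sub>v \<eta> i)" if i: "i < p" for i
    unfolding ws\<eta>[OF i] unfolding W\<eta>[OF i] Q\<eta>[OF i] eq[OF i, symmetric] root[symmetric]
    by (rule shift[OF Wc[OF i] Wc[OF q(1)]]) (use cHt hw[OF i] in simp)
  have "\<eta> q = 0\<^sub>v n" using \<xi>q by (simp add: \<eta>_def)
  then have "?hw (\<eta> q) = 0\<^sub>v m"
    by (simp add: mat_mult_vec_zero[OF cW] mat_mult_vec_zero[OF cH])
  then have "cvec_norm2 (?hw (\<eta> q)) = 0" by (simp add: cvec_norm2_def)
  then have "cvec_norm2 (?hw (\<eta> j)) \<le> 0" if "j < p" for j
    using unstable_mode_at_root(1)[OF conn q W Q WQ H HH \<eta> \<mu> eq\<eta> that]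
    by simp
  then have hw0: "?hw (\<eta> j) = 0\<^sub>v m" if "j < p" for j
    using cvec_norm2_nonneg[of "?hw (\<eta> j)"] cvec_norm2_eq_0[of "?hw (\<eta> j)"] H that by force
  then have "?ws i (\<lambda>j. ?hw (\<eta> j)) - ?hw (\<eta> i) = 0\<^sub>v m"
    using i by (intro eq_vecI) (auto simp: weighted_sum_def)
  moreover have "cmat (transpose_mat H) *\<^sub>v 0\<^sub>v m = 0\<^sub>v n" using H by (intro eq_vecI) auto
  ultimately have "cmat W *\<^sub>v \<eta> i = \<mu> \<cdot>\<^sub>v (cmat Q *\<^sub>v \<eta> i)"
    using eq\<eta>[OF i] cW \<eta>[OF i] by simp
  from observable[OF \<eta>[OF i] this hw0[OF i]] have 0: "\<xi> i - \<xi> q = 0\<^sub>v n" by (simp add: \<eta>_def)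
  show ?thesis
  proof (rule eq_vecI)
    fix a assume "a < dim_vec (\<xi> q)"
    then have "a < n" using \<xi>q by simp
    then have "(\<xi> i - \<xi> q) $ a = 0" using 0 by simp
    then show "\<xi> i $ a = \<xi> q $ a" using \<xi>q \<open>a < n\<close> by simp
  qed (use \<xi>[OF i] \<xi>q in simp)
qed

lemma cmat_mult_mult_vec:
  assumes "M \<in> carrier_mat a b" "M' \<in> carrier_mat b c" "v \<in> carrier_vec c"
  shows "cmat (M * M') *\<^sub>v v = cmat M *\<^sub>v (cmat M' *\<^sub>v v)"
proof -
  have "cmat (M * M') = cmat M * cmat M'" by (rule of_real_hom.mat_hom_mult[OF assms(1,2)])
  then show ?thesis using assms by (simp add: assoc_mult_mat_vec[of _ a b _ c])
qed

lemma left_inverse_mult_vec_eq_0: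
  assumes "M \<in> carrier_mat a b" "M' \<in> carrier_mat b a" "M' * M = 1\<^sub>m b"
    and v: "v \<in> carrier_vec b" and 0: "cmat M *\<^sub>v v = 0\<^sub>v a"
  shows "v = 0\<^sub>v b"
proof -
  have "cmat (M' * M) *\<^sub>v v = 0\<^sub>v b"
    unfolding cmat_mult_mult_vec[OF assms(2,1) v] 0 by (rule mat_mult_vec_zero) (use assms in simp)
  then show ?thesis using assms(3) v by (simp add: of_real_hom.mat_hom_one)
qed

text \<open>Multiplying the eigenvector equation by \<open>Q U\<^sup>T\<close> yields an equation in
  \<xi> alone, of the shape treated by \<open>unstable_mode_synchronized\<close>. Once the \<xi>
  agree, the coupling vanishes and differences of the \<open>v i\<close> are modes of
  \<open>A\<^sup>T\<close> outside the unit-circle block, hence zero. The common value itself may be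
  nonzero, since \<open>A\<^sup>T\<close> can have eigenvalues on the unit circle. For
  \<open>n1 = 0\<close> the gain is zero and no such eigenvalue exists.\<close>

lemma gain_modes_synchronized:
  fixes v :: "nat \<Rightarrow> complex vec"
  assumes A: "A \<in> carrier_mat n n" and C: "C \<in> carrier_mat m n"
    and stable: "neutrally_stable A" and det: "detectable C A"
    and gain: "constructed_gain n m A C L"
    and conn: "connected_matrix p \<Lambda>"
    and q: "q < p" "\<And>i. i < p \<Longrightarrow> (i, q) \<in> (mat_arcs p \<Lambda>)\<^sup>*"
    and v: "\<And>i. i < p \<Longrightarrow> v i \<in> carrier_vec n"
    and \<mu>: "1 \<le> cmod \<mu>"
    and eq: "\<And>i. i < p \<Longrightarrow> cmat (transpose_mat A) *\<^sub>v v i + cmat (transpose_mat C * transpose_mat L) *\<^sub>v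
      (weighted_sum n p (\<lambda>j. complex_of_real (\<Lambda> $$ (i, j))) v - v i) = \<mu> \<cdot>\<^sub>v v i"
    and i: "i < p"
  shows "v i = v q"
proof -
  let ?ws = "\<lambda>k i v. weighted_sum k p (\<lambda>j. complex_of_real (\<Lambda> $$ (i, j))) v"
  have At: "transpose_mat A \<in> carrier_mat n n" and cAt: "cmat (transpose_mat A) \<in> carrier_mat n n"
    and Ct: "transpose_mat C \<in> carrier_mat n m" using A C by auto
  \<comment> \<open>Neutral stability bounds the eigenvalues of \<open>A\<close> by one in modulus,
    so an actual eigenvector forces \<mu> onto the unit circle.\<close>
  have unit: "cmod \<mu> = 1" "eigenvalue (cmat A) \<mu>"
    if d: "d \<in> carrier_vec n" "d \<noteq> 0\<^sub>v n" "cmat (transpose_mat A) *\<^sub>v d = \<mu> \<cdot>\<^sub>v d" for d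
  proof -
    have "eigenvalue (cmat (transpose_mat A)) \<mu>"
      using d A by (auto simp: eigenvalue_def eigenvector_def)
    then show *: "eigenvalue (cmat A) \<mu>"
      using eigenvalue_transpose[of "cmat A" n] A by (simp add: map_mat_transpose)
    then show "cmod \<mu> = 1" using stable \<mu> by (auto simp: neutrally_stable_def intro: antisym)
  qed
  have diff: "v i \<in> carrier_vec n" "v q \<in> carrier_vec n" "v i - v q \<in> carrier_vec n"
    using v i q(1) by auto
  have final: "v i = v q" if "v i - v q = 0\<^sub>v n"
  proof (rule eq_vecI)
    fix a assume "a < dim_vec (v q)"
    then have "a < n" using diff by simp
    then have "(v i - v q) $ a = 0" using that by simp
    then show "v i $ a = v q $ a" using diff \<open>a < n\<close> by simp
  qed (use diff in simp)
  have eigen_diff: "cmat (transpose_mat A) *\<^sub>v (v i - v q) = \<mu> \<cdot>\<^sub>v (v i - v q)"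
    if *: "\<And>j. j < p \<Longrightarrow> cmat (transpose_mat A) *\<^sub>v v j = \<mu> \<cdot>\<^sub>v v j"
    unfolding mult_minus_distrib_mat_vec[OF cAt diff(1,2)] *[OF i] *[OF q(1)]
    using diff by (intro eq_vecI) (auto simp: algebra_simps)
  define n1 where "n1 = num_unit_eigenvalues A"
  show ?thesis
  proof (cases "n1 = 0")
    case True
    then have L: "L = 0\<^sub>m n m" using gain by (simp add: constructed_gain_def n1_def)
    have "transpose_mat C * transpose_mat L = 0\<^sub>m n n" using Ct by (simp add: L)
    then have "cmat (transpose_mat C * transpose_mat L) *\<^sub>v d = 0\<^sub>v n" if "d \<in> carrier_vec n" for d
      using that by (auto intro!: eq_vecI simp: scalar_prod_def)
    then have "cmat (transpose_mat A) *\<^sub>v v j = \<mu> \<cdot>\<^sub>v v j" if "j < p" for j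
      using eq[OF that] v[OF that] At by simp
    then have ev: "cmat (transpose_mat A) *\<^sub>v (v i - v q) = \<mu> \<cdot>\<^sub>v (v i - v q)" by (rule eigen_diff)
    show ?thesis
    proof (rule final, rule ccontr)
      assume "v i - v q \<noteq> 0\<^sub>v n"
      from unit[OF diff(3) this ev] num_unit_eigenvalues_0[OF A] True show False
        by (auto simp: n1_def)
    qed
  next
    case False
    obtain U U' F Q Q' H N where
      U: "U \<in> carrier_mat n n1" and U': "U' \<in> carrier_mat n1 n" "U' * U = 1\<^sub>m n1" and
      F: "F \<in> carrier_mat n1 n1" and AU: "A * U = U * F" and
      Q: "Q \<in> carrier_mat n1 n1" and Q': "Q' \<in> carrier_mat n1 n1" "Q' * Q = 1\<^sub>m n1" and
      Qt: "transpose_mat Q = Q" and FQF: "F * (Q * Q) * transpose_mat F = Q * Q" and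
      H: "H \<in> carrier_mat m n1" and HH: "H * transpose_mat H = 1\<^sub>m m" and
      N: "N \<in> carrier_mat m m" and NH: "C * (U * Q) = N * H" and
      L: "L \<in> carrier_mat n m" and
      YL: "(Q * (transpose_mat U * transpose_mat C)) * transpose_mat L =
         transpose_mat H * (H * (Q * (transpose_mat F * transpose_mat U)))" and
      compl: "\<And>v z. v \<in> carrier_vec n \<Longrightarrow> cmat (transpose_mat A) *\<^sub>v v = z \<cdot>\<^sub>v v \<Longrightarrow>
         cmat (transpose_mat U) *\<^sub>v v = 0\<^sub>v n1 \<Longrightarrow> cmod z = 1 \<Longrightarrow> v = 0\<^sub>v n" and
      X: "\<exists>X \<in> carrier_mat n1 m. L = U * X"
      by (rule constructed_gain_data[OF A C gain n1_def False]) (rule that; assumption)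
    have Ut: "transpose_mat U \<in> carrier_mat n1 n" and Ft: "transpose_mat F \<in> carrier_mat n1 n1"
      and Ht: "transpose_mat H \<in> carrier_mat n1 m" and Lt: "transpose_mat L \<in> carrier_mat m n"
      using U F H L by auto
    \<comment> \<open>This \<open>W\<close> is not the complementary basis of the construction. The
      invariance of \<open>Q * Q\<close> under \<open>F\<close> says precisely that \<open>W\<close>
      and \<open>Q\<close> have the same Gram matrix.\<close>
    define W where "W = Q * transpose_mat F"
    have W: "W \<in> carrier_mat n1 n1" using Q Ft by (simp add: W_def)
    have FQ: "F * Q \<in> carrier_mat n1 n1" and QQ: "Q * Q \<in> carrier_mat n1 n1" using F Q by auto
    have Wt: "transpose_mat W = F * Q"
      unfolding W_def transpose_mult[OF Q Ft] using Qt by simp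
    have WQ: "transpose_mat W * W = transpose_mat Q * Q"
    proof -
      have "transpose_mat W * W = ((F * Q) * Q) * transpose_mat F"
        unfolding Wt unfolding W_def by (rule assoc_mult_mat[OF FQ Q Ft, symmetric])
      also have "(F * Q) * Q = F * (Q * Q)" by (rule assoc_mult_mat[OF F Q Q])
      finally show ?thesis using FQF Qt by simp
    qed
    define \<xi> where "\<xi> i = cmat (transpose_mat U) *\<^sub>v v i" for i
    have cUt: "cmat (transpose_mat U) \<in> carrier_mat n1 n" using U by simp
    have \<xi>: "\<xi> i \<in> carrier_vec n1" if "i < p" for i using v[OF that] U by (simp add: \<xi>_def)
    let ?P = "Q * transpose_mat U"
    have P: "?P \<in> carrier_mat n1 n" and cP: "cmat ?P \<in> carrier_mat n1 n" using Q Ut by auto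
    have M: "transpose_mat C * transpose_mat L \<in> carrier_mat n n" using Ct Lt by simp
    have PA: "?P * transpose_mat A = W * transpose_mat U"
    proof -
      have "?P * transpose_mat A = Q * (transpose_mat U * transpose_mat A)"
        by (rule assoc_mult_mat[OF Q Ut At])
      also have "transpose_mat U * transpose_mat A = transpose_mat F * transpose_mat U"
        unfolding transpose_mult[OF A U, symmetric] transpose_mult[OF U F, symmetric] AU ..
      also have "Q * (transpose_mat F * transpose_mat U) = W * transpose_mat U"
        unfolding W_def by (rule assoc_mult_mat[OF Q Ft Ut, symmetric])
      finally show ?thesis .
    qed
    have HW: "H * W \<in> carrier_mat m n1" using H W by simp
    have PM: "?P * (transpose_mat C * transpose_mat L) = transpose_mat H * (H * W * transpose_mat U)"
    proof -
      have "?P * (transpose_mat C * transpose_mat L) = (?P * transpose_mat C) * transpose_mat L"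
        by (rule assoc_mult_mat[OF P Ct Lt, symmetric])
      also have "?P * transpose_mat C = Q * (transpose_mat U * transpose_mat C)"
        by (rule assoc_mult_mat[OF Q Ut Ct])
      also note YL
      also have "H * (Q * (transpose_mat F * transpose_mat U)) = H * W * transpose_mat U"
        unfolding W_def
        by (simp only: assoc_mult_mat[OF H mult_carrier_mat[OF Q Ft] Ut] assoc_mult_mat[OF Q Ft Ut])
      finally show ?thesis .
    qed
    have Pv: "cmat Q *\<^sub>v (cmat (transpose_mat U) *\<^sub>v d) = cmat ?P *\<^sub>v d" if "d \<in> carrier_vec n" for d
      by (rule cmat_mult_mult_vec[OF Q Ut that, symmetric])
    have HWv: "cmat (H * W) *\<^sub>v d = cmat H *\<^sub>v (cmat W *\<^sub>v d)" if "d \<in> carrier_vec n1" for d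
      by (rule cmat_mult_mult_vec[OF H W that])
    have cHW: "cmat (H * W) \<in> carrier_mat m n1" using HW by simp
    have U_diff: "cmat (transpose_mat U) *\<^sub>v (?ws n i v - v i) = ?ws n1 i \<xi> - \<xi> i" if i: "i < p" for i
    proof -
      have "cmat (transpose_mat U) *\<^sub>v ?ws n i v = ?ws n1 i \<xi>"
        unfolding \<xi>_def by (rule mult_mat_weighted_sum[OF cUt v])
      then show ?thesis
        unfolding mult_minus_distrib_mat_vec[OF cUt weighted_sum_carrier v[OF i]] \<xi>_def by simp
    qed
    have eq\<xi>: "cmat W *\<^sub>v \<xi> i + cmat (transpose_mat H) *\<^sub>v
        (?ws m i (\<lambda>j. cmat H *\<^sub>v (cmat W *\<^sub>v \<xi> j)) - cmat H *\<^sub>v (cmat W *\<^sub>v \<xi> i)) = \<mu> \<cdot>\<^sub>v (cmat Q *\<^sub>v \<xi> i)"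
      if i: "i < p" for i
    proof -
      let ?d = "?ws n i v - v i"
      have d: "?d \<in> carrier_vec n" using v[OF i] by simp
      have "\<mu> \<cdot>\<^sub>v (cmat Q *\<^sub>v \<xi> i) = cmat ?P *\<^sub>v (\<mu> \<cdot>\<^sub>v v i)"
        unfolding \<xi>_def Pv[OF v[OF i]] by (rule mult_mat_vec[OF cP v[OF i], symmetric])
      also have "\<dots> = cmat ?P *\<^sub>v (cmat (transpose_mat A) *\<^sub>v v i)
          + cmat ?P *\<^sub>v (cmat (transpose_mat C * transpose_mat L) *\<^sub>v ?d)"
        unfolding eq[OF i, symmetric]
        by (rule mult_add_distrib_mat_vec[OF cP]) (use cAt M v[OF i] d in auto)
      also have "cmat ?P *\<^sub>v (cmat (transpose_mat A) *\<^sub>v v i) = cmat W *\<^sub>v \<xi> i"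
        unfolding cmat_mult_mult_vec[OF P At v[OF i], symmetric] PA \<xi>_def
        by (rule cmat_mult_mult_vec[OF W Ut v[OF i]])
      also have "cmat ?P *\<^sub>v (cmat (transpose_mat C * transpose_mat L) *\<^sub>v ?d)
          = cmat (transpose_mat H) *\<^sub>v (cmat (H * W) *\<^sub>v (?ws n1 i \<xi> - \<xi> i))"
        unfolding cmat_mult_mult_vec[OF P M d, symmetric] PM U_diff[OF i, symmetric]
          cmat_mult_mult_vec[OF HW Ut d, symmetric]
        by (rule cmat_mult_mult_vec[OF Ht _ d]) (use HW Ut in simp)
      also have "cmat (H * W) *\<^sub>v (?ws n1 i \<xi> - \<xi> i)
          = ?ws m i (\<lambda>j. cmat (H * W) *\<^sub>v \<xi> j) - cmat (H * W) *\<^sub>v \<xi> i"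
        unfolding mult_minus_distrib_mat_vec[OF cHW weighted_sum_carrier \<xi>[OF i]]
        by (rule arg_cong[where f = "\<lambda>t. t - _"], rule mult_mat_weighted_sum[OF cHW \<xi>])
      also have "?ws m i (\<lambda>j. cmat (H * W) *\<^sub>v \<xi> j) = ?ws m i (\<lambda>j. cmat H *\<^sub>v (cmat W *\<^sub>v \<xi> j))"
        using HWv[OF \<xi>] by (simp add: weighted_sum_def)
      finally show ?thesis unfolding HWv[OF \<xi>[OF i]] ..
    qed
    \<comment> \<open>Put \<open>\<zeta> = Q \<eta>\<close>. Comparing Gram matrices gives
      \<open>Q \<zeta> = \<mu> F Q \<zeta>\<close>, so \<open>y = U Q \<zeta>\<close> satisfies
      \<open>y = \<mu> A y\<close>. This turns the mode of the transposed system into an eigenvector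
      of \<open>A\<close> itself for the eigenvalue \<open>inverse \<mu>\<close>, and
      \<open>C y = N H \<zeta> = 0\<close>, so detectability of \<open>(C, A)\<close>
      applies.\<close>
    have observable: "\<eta> = 0\<^sub>v n1" if \<eta>: "\<eta> \<in> carrier_vec n1"
      and ev: "cmat W *\<^sub>v \<eta> = \<mu> \<cdot>\<^sub>v (cmat Q *\<^sub>v \<eta>)" and 0: "cmat H *\<^sub>v (cmat W *\<^sub>v \<eta>) = 0\<^sub>v m" for \<eta>
    proof -
      have cQ: "cmat Q \<in> carrier_mat n1 n1" and cH: "cmat H \<in> carrier_mat m n1"
        and cA: "cmat A \<in> carrier_mat n n" and cU: "cmat U \<in> carrier_mat n n1"
        and cFQ: "cmat (F * Q) \<in> carrier_mat n1 n1" using Q H A U FQ by auto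
      define \<zeta> where "\<zeta> = cmat Q *\<^sub>v \<eta>"
      have \<zeta>: "\<zeta> \<in> carrier_vec n1" using cQ \<eta> by (simp add: \<zeta>_def)
      have UQ: "U * Q \<in> carrier_mat n n1" and cUQ: "cmat (U * Q) \<in> carrier_mat n n1" using U Q by auto
      define y where "y = cmat (U * Q) *\<^sub>v \<zeta>"
      have y: "y \<in> carrier_vec n" using cUQ \<zeta> by (simp add: y_def)
      have \<mu>0: "\<mu> \<noteq> 0" using \<mu> by auto
      have "\<zeta> = 0\<^sub>v n1"
      proof (rule ccontr)
        assume nz: "\<zeta> \<noteq> 0\<^sub>v n1"
        have pos: "cvec_norm2 \<zeta> > 0"
          using nz \<zeta> cvec_norm2_nonneg[of \<zeta>] cvec_norm2_eq_0[of \<zeta>] by (auto simp: less_le)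
        \<comment> \<open>The lower bound on the modulus of \<mu> is not enough here: detectability
          is applied to \<open>inverse \<mu>\<close>, whose modulus must be at least one. Equality
          of norms forces modulus one.\<close>
        have "(cmod \<mu>)\<^sup>2 * cvec_norm2 \<zeta> = cvec_norm2 \<zeta>"
          using cvec_norm2_isometry[OF W Q WQ \<eta>] ev by (simp add: cvec_norm2_smult \<zeta>_def)
        then have "(cmod \<mu>)\<^sup>2 = 1" using pos by simp
        then have \<mu>1: "cmod \<mu> = 1" using \<mu> by (auto simp: power2_eq_1_iff)
        have FW: "cmat (F * Q) *\<^sub>v (cmat W *\<^sub>v \<eta>) = cmat Q *\<^sub>v \<zeta>"
        proof -
          have "cmat (F * Q) *\<^sub>v (cmat W *\<^sub>v \<eta>) = cmat (transpose_mat W * W) *\<^sub>v \<eta>"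
            unfolding Wt by (rule cmat_mult_mult_vec[OF FQ W \<eta>, symmetric])
          also have "\<dots> = cmat Q *\<^sub>v \<zeta>"
            unfolding WQ Qt \<zeta>_def by (rule cmat_mult_mult_vec[OF Q Q \<eta>])
          finally show ?thesis .
        qed
        have "y = cmat U *\<^sub>v (cmat Q *\<^sub>v \<zeta>)"
          unfolding y_def by (rule cmat_mult_mult_vec[OF U Q \<zeta>])
        also have "\<dots> = cmat U *\<^sub>v (\<mu> \<cdot>\<^sub>v (cmat (F * Q) *\<^sub>v \<zeta>))"
          unfolding FW[symmetric] ev \<zeta>_def[symmetric] mult_mat_vec[OF cFQ \<zeta>] ..
        also have "\<dots> = \<mu> \<cdot>\<^sub>v (cmat U *\<^sub>v (cmat (F * Q) *\<^sub>v \<zeta>))"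
          by (rule mult_mat_vec[OF cU]) (use cFQ \<zeta> in simp)
        also have "cmat U *\<^sub>v (cmat (F * Q) *\<^sub>v \<zeta>) = cmat (U * (F * Q)) *\<^sub>v \<zeta>"
          by (rule cmat_mult_mult_vec[OF U FQ \<zeta>, symmetric])
        also have "U * (F * Q) = A * (U * Q)"
          unfolding assoc_mult_mat[OF U F Q, symmetric] AU[symmetric] by (rule assoc_mult_mat[OF A U Q])
        also have "cmat (A * (U * Q)) *\<^sub>v \<zeta> = cmat A *\<^sub>v y"
          unfolding y_def by (rule cmat_mult_mult_vec[OF A UQ \<zeta>])
        finally have yA: "y = \<mu> \<cdot>\<^sub>v (cmat A *\<^sub>v y)" .
        have "cmat A *\<^sub>v y = inverse \<mu> \<cdot>\<^sub>v (\<mu> \<cdot>\<^sub>v (cmat A *\<^sub>v y))"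
          using \<mu>0 by (simp add: smult_smult_assoc)
        then have Ay: "cmat A *\<^sub>v y = inverse \<mu> \<cdot>\<^sub>v y" unfolding yA[symmetric] .
        have "\<mu> \<cdot>\<^sub>v (cmat H *\<^sub>v \<zeta>) = 0\<^sub>v m"
          using 0 unfolding ev \<zeta>_def[symmetric] mult_mat_vec[OF cH \<zeta>] .
        then have "inverse \<mu> \<cdot>\<^sub>v (\<mu> \<cdot>\<^sub>v (cmat H *\<^sub>v \<zeta>)) = 0\<^sub>v m" by (auto intro!: eq_vecI)
        then have H\<zeta>: "cmat H *\<^sub>v \<zeta> = 0\<^sub>v m" using \<mu>0 by (simp add: smult_smult_assoc)
        have "cmat C *\<^sub>v y = cmat (N * H) *\<^sub>v \<zeta>"
          unfolding y_def NH[symmetric] by (rule cmat_mult_mult_vec[OF C UQ \<zeta>, symmetric])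
        also have "\<dots> = 0\<^sub>v m"
          unfolding cmat_mult_mult_vec[OF N H \<zeta>] H\<zeta> by (rule mat_mult_vec_zero) (use N in simp)
        finally have Cy: "cmat C *\<^sub>v y = 0\<^sub>v m" .
        have "1 \<le> cmod (inverse \<mu>)" using \<mu>1 by (simp add: norm_inverse)
        from detectable_eigenvector[OF det A C y Ay this Cy] have y0: "y = 0\<^sub>v n" .
        have "cmat U *\<^sub>v (cmat Q *\<^sub>v \<zeta>) = 0\<^sub>v n"
          using y0 unfolding y_def cmat_mult_mult_vec[OF U Q \<zeta>] .
        from left_inverse_mult_vec_eq_0[OF U U' _ this] have "cmat Q *\<^sub>v \<zeta> = 0\<^sub>v n1" using cQ \<zeta> by simp
        from left_inverse_mult_vec_eq_0[OF Q Q' \<zeta> this] nz show False by simp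
      qed
      then show ?thesis unfolding \<zeta>_def by (rule left_inverse_mult_vec_eq_0[OF Q Q' \<eta>])
    qed
    have sync: "\<xi> j = \<xi> q" if "j < p" for j
      by (rule unstable_mode_synchronized[OF conn q W Q WQ H HH \<xi> \<mu> eq\<xi> observable that])
    obtain X where X: "X \<in> carrier_mat n1 m" "L = U * X" using X by blast
    have Xt: "transpose_mat X \<in> carrier_mat m n1" using X by simp
    have "cmat (transpose_mat A) *\<^sub>v v j = \<mu> \<cdot>\<^sub>v v j" if j: "j < p" for j
    proof -
      let ?d = "?ws n j v - v j"
      have d: "?d \<in> carrier_vec n" using v[OF j] by simp
      \<comment> \<open>All \<xi> agree and the row sums are one, so averaging changes nothing; thus
        the coupling \<open>?d\<close> is killed by \<open>U\<^sup>T\<close>, and by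
        \<open>L = U * X\<close> also by \<open>L\<^sup>T\<close>.\<close>
      have "?ws n1 j \<xi> = \<xi> j"
        using sync connected_matrix_row_sum[OF conn j] \<xi>[OF q(1)] j
        by (intro eq_vecI) (auto simp: weighted_sum_def simp flip: sum_distrib_right)
      then have "cmat (transpose_mat U) *\<^sub>v ?d = 0\<^sub>v n1"
        unfolding U_diff[OF j] using \<xi>[OF j] by simp
      then have "cmat (transpose_mat L) *\<^sub>v ?d = 0\<^sub>v m"
        unfolding X(2) transpose_mult[OF U X(1)] cmat_mult_mult_vec[OF Xt Ut d]
        using mat_mult_vec_zero[of "cmat (transpose_mat X)" m n1] Xt by simp
      then have "cmat (transpose_mat C * transpose_mat L) *\<^sub>v ?d = 0\<^sub>v n"
        unfolding cmat_mult_mult_vec[OF Ct Lt d]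
        using mat_mult_vec_zero[of "cmat (transpose_mat C)" n m] Ct by simp
      then show ?thesis using eq[OF j] cAt v[OF j] by simp
    qed
    then have ev: "cmat (transpose_mat A) *\<^sub>v (v i - v q) = \<mu> \<cdot>\<^sub>v (v i - v q)" by (rule eigen_diff)
    have U0: "cmat (transpose_mat U) *\<^sub>v (v i - v q) = 0\<^sub>v n1"
      unfolding mult_minus_distrib_mat_vec[OF cUt diff(1,2)] \<xi>_def[symmetric] sync[OF i]
      using \<xi>[OF q(1)] by simp
    show ?thesis
    proof (rule final, rule ccontr)
      assume nz: "v i - v q \<noteq> 0\<^sub>v n"
      from compl[OF diff(3) ev U0 unit(1)[OF diff(3) nz ev]] nz show False by simp
    qed
  qed
qed

section \<open>Error dynamics\<close>

text \<open>After exchanging the sums, the weights \<open>r j * c j l\<close> add up to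
  \<open>r l\<close>, so the two coupling contributions cancel. It applies to the real trajectories
  and to the complex modes alike.\<close>

lemma left_eigenvector_average:
  fixes A M :: "'a :: field mat"
  assumes A: "A \<in> carrier_mat n n" and M: "M \<in> carrier_mat n n"
    and v: "\<And>j. j < p \<Longrightarrow> v j \<in> carrier_vec n"
    and r: "\<And>l. l < p \<Longrightarrow> (\<Sum>j<p. r j * c j l) = r l"
  shows "weighted_sum n p r (\<lambda>j. A *\<^sub>v v j + M *\<^sub>v (weighted_sum n p (c j) v - v j))
    = A *\<^sub>v weighted_sum n p r v"
proof (rule eq_vecI)
  fix a assume "a < dim_vec (A *\<^sub>v weighted_sum n p r v)"
  then have a: "a < n" using A by simp
  have Aw: "A *\<^sub>v weighted_sum n p d v = weighted_sum n p d (\<lambda>j. A *\<^sub>v v j)" for d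
    by (rule mult_mat_weighted_sum[OF A v])
  have Mw: "M *\<^sub>v weighted_sum n p d v = weighted_sum n p d (\<lambda>j. M *\<^sub>v v j)" for d
    by (rule mult_mat_weighted_sum[OF M v])
  let ?w = "\<lambda>l. (M *\<^sub>v v l) $ a"
  have coupling: "(M *\<^sub>v (weighted_sum n p (c j) v - v j)) $ a = (\<Sum>l<p. c j l * ?w l) - ?w j" if j: "j < p" for j
    unfolding mult_minus_distrib_mat_vec[OF M weighted_sum_carrier v[OF j]] Mw
    using a M by (simp add: weighted_sum_def)
  have "weighted_sum n p r (\<lambda>j. A *\<^sub>v v j + M *\<^sub>v (weighted_sum n p (c j) v - v j)) $ a
      = (\<Sum>j<p. r j * ((A *\<^sub>v v j) $ a + (M *\<^sub>v (weighted_sum n p (c j) v - v j)) $ a))"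
    using a A M by (simp add: weighted_sum_def)
  also have "\<dots> = (\<Sum>j<p. r j * (A *\<^sub>v v j) $ a + ((\<Sum>l<p. r j * c j l * ?w l) - r j * ?w j))"
    by (intro sum.cong) (simp_all add: coupling distrib_left right_diff_distrib sum_distrib_left mult.assoc)
  also have "\<dots> = (\<Sum>j<p. r j * (A *\<^sub>v v j) $ a)
      + ((\<Sum>j<p. \<Sum>l<p. r j * c j l * ?w l) - (\<Sum>j<p. r j * ?w j))"
    by (simp add: sum.distrib sum_subtractf)
  also have "(\<Sum>j<p. \<Sum>l<p. r j * c j l * ?w l) = (\<Sum>l<p. (\<Sum>j<p. r j * c j l) * ?w l)"
    unfolding sum_distrib_right by (rule sum.swap)
  also have "\<dots> = (\<Sum>l<p. r l * ?w l)" using r by simp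
  also have "(\<Sum>j<p. r j * (A *\<^sub>v v j) $ a) = (A *\<^sub>v weighted_sum n p r v) $ a"
    unfolding Aw using a by (simp add: weighted_sum_def)
  finally show "weighted_sum n p r (\<lambda>j. A *\<^sub>v v j + M *\<^sub>v (weighted_sum n p (c j) v - v j)) $ a
    = (A *\<^sub>v weighted_sum n p r v) $ a" by simp
qed (use A in \<open>simp add: weighted_sum_def\<close>)

text \<open>Subtracting \<open>r\<^sub>j A\<close> leaves the error dynamics unchanged, as the errors have weighted
  average zero, and removes the persistent modes common to all nodes.\<close>

definition error_block :: "nat \<Rightarrow> 'a :: field mat \<Rightarrow> 'a mat \<Rightarrow> (nat \<Rightarrow> nat \<Rightarrow> 'a) \<Rightarrow> (nat \<Rightarrow> 'a) \<Rightarrow>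
    nat \<Rightarrow> nat \<Rightarrow> 'a mat" where
  "error_block n A M c r i j = mat n n (\<lambda>(a, b).
     (if i = j then A $$ (a, b) - M $$ (a, b) else 0) + c i j * M $$ (a, b) - r j * A $$ (a, b))"

lemma error_block_carrier [simp]: "error_block n A M c r i j \<in> carrier_mat n n"
  by (simp add: error_block_def)

text \<open>Translates between the block form, whose eigenvalues decide convergence, and the
  weighted averages in which the coupling is analysed.\<close>

lemma sum_error_block:
  assumes A: "A \<in> carrier_mat n n" and M: "M \<in> carrier_mat n n"
    and v: "\<And>j. j < p \<Longrightarrow> v j \<in> carrier_vec n" and i: "i < p" and a: "a < n"
  shows "(\<Sum>j<p. (error_block n A M c r i j *\<^sub>v v j) $ a)
    = (A *\<^sub>v v i + M *\<^sub>v (weighted_sum n p (c i) v - v i)) $ a - (A *\<^sub>v weighted_sum n p r v) $ a"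
proof -
  have Aw: "A *\<^sub>v weighted_sum n p d v = weighted_sum n p d (\<lambda>j. A *\<^sub>v v j)" for d
    by (rule mult_mat_weighted_sum[OF A v])
  have Mw: "M *\<^sub>v weighted_sum n p d v = weighted_sum n p d (\<lambda>j. M *\<^sub>v v j)" for d
    by (rule mult_mat_weighted_sum[OF M v])
  let ?A = "\<lambda>j. (A *\<^sub>v v j) $ a" and ?M = "\<lambda>j. (M *\<^sub>v v j) $ a"
  have "(error_block n A M c r i j *\<^sub>v v j) $ a
      = (if j = i then ?A i - ?M i else 0) + c i j * ?M j - r j * ?A j" if j: "j < p" for j
  proof -
    have "(error_block n A M c r i j *\<^sub>v v j) $ a = (\<Sum>b<n. (if i = j then A $$ (a, b) * v j $ b - M $$ (a, b) * v j $ b else 0)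
        + c i j * (M $$ (a, b) * v j $ b) - r j * (A $$ (a, b) * v j $ b))"
      using a carrier_vecD[OF v[OF j]]
      by (auto simp: error_block_def scalar_prod_def atLeast0LessThan algebra_simps intro!: sum.cong)
    also have "\<dots> = (if i = j then (\<Sum>b<n. A $$ (a, b) * v j $ b) - (\<Sum>b<n. M $$ (a, b) * v j $ b) else 0)
        + c i j * (\<Sum>b<n. M $$ (a, b) * v j $ b) - r j * (\<Sum>b<n. A $$ (a, b) * v j $ b)"
      by (simp add: sum.distrib sum_subtractf sum_distrib_left)
    also have "(\<Sum>b<n. A $$ (a, b) * v j $ b) = ?A j"
      using a A carrier_vecD[OF v[OF j]] by (simp add: scalar_prod_def atLeast0LessThan)
    also have "(\<Sum>b<n. M $$ (a, b) * v j $ b) = ?M j"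
      using a M carrier_vecD[OF v[OF j]] by (simp add: scalar_prod_def atLeast0LessThan)
    finally show ?thesis by auto
  qed
  then have "(\<Sum>j<p. (error_block n A M c r i j *\<^sub>v v j) $ a)
      = (\<Sum>j<p. (if j = i then ?A i - ?M i else 0) + c i j * ?M j - r j * ?A j)"
    by (intro sum.cong) auto
  also have "\<dots> = ?A i - ?M i + (\<Sum>j<p. c i j * ?M j) - (\<Sum>j<p. r j * ?A j)"
    using i by (simp add: sum.distrib sum_subtractf)
  also have "(\<Sum>j<p. c i j * ?M j) - ?M i = (M *\<^sub>v (weighted_sum n p (c i) v - v i)) $ a"
    unfolding mult_minus_distrib_mat_vec[OF M weighted_sum_carrier v[OF i]] Mw
    using a M by (simp add: weighted_sum_def)
  moreover have "(\<Sum>j<p. r j * ?A j) = (A *\<^sub>v weighted_sum n p r v) $ a"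
    unfolding Aw using a by (simp add: weighted_sum_def)
  ultimately show ?thesis
    using a A M by (simp add: algebra_simps)
qed

lemma kronecker_row_mult_stack:
  fixes r :: "'a :: field vec"
  assumes B: "B \<in> carrier_mat n n" and r: "r \<in> carrier_vec p"
    and v: "\<And>j. j < p \<Longrightarrow> v j \<in> carrier_vec n"
  shows "kronecker_prod (mat_of_row r) B *\<^sub>v stack_vecs p n v = B *\<^sub>v weighted_sum n p (($) r) v"
proof (rule eq_vecI)
  fix a assume "a < dim_vec (B *\<^sub>v weighted_sum n p (($) r) v)"
  then have a: "a < n" using B by simp
  have Bw: "B *\<^sub>v weighted_sum n p d v = weighted_sum n p d (\<lambda>j. B *\<^sub>v v j)" for d
    by (rule mult_mat_weighted_sum[OF B v])
  have "(kronecker_prod (mat_of_row r) B *\<^sub>v stack_vecs p n v) $ a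
      = (\<Sum>s<p * n. r $ (s div n) * B $$ (a, s mod n) * v (s div n) $ (s mod n))"
    using a B r by (simp add: kronecker_prod_def stack_vecs_def scalar_prod_def atLeast0LessThan mat_of_row_def less_mult_imp_div_less)
  also have "\<dots> = (\<Sum>j<p. \<Sum>b<n. r $ j * B $$ (a, b) * v j $ b)"
    unfolding sum_lessThan_blocks by (intro sum.cong) auto
  also have "\<dots> = (\<Sum>j<p. r $ j * (B *\<^sub>v v j) $ a)"
    using a B carrier_vecD[OF v]
    by (intro sum.cong) (auto simp: scalar_prod_def atLeast0LessThan sum_distrib_left mult.assoc)
  also have "\<dots> = (B *\<^sub>v weighted_sum n p (($) r) v) $ a"
    unfolding Bw using a by (simp add: weighted_sum_def)
  finally show "(kronecker_prod (mat_of_row r) B *\<^sub>v stack_vecs p n v) $ a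
    = (B *\<^sub>v weighted_sum n p (($) r) v) $ a" .
qed (use B r in \<open>simp add: kronecker_prod_def mat_of_row_def\<close>)

text \<open>Averaging the eigenvector equation with \<open>r\<close> makes the image of the average
  under \<open>A\<^sup>T\<close> appear with both signs, so \<mu> times the average is zero, and
  hence the average itself. The correction term then disappears, the \<open>v i\<close> form a mode
  of the coupled system and agree; their common value is their average, which is zero.\<close>

lemma error_block_no_unstable_mode:
  fixes v :: "nat \<Rightarrow> complex vec"
  assumes A: "A \<in> carrier_mat n n" and C: "C \<in> carrier_mat m n" and L: "L \<in> carrier_mat n m"
    and stable: "neutrally_stable A" and det: "detectable C A"
    and gain: "constructed_gain n m A C L"
    and conn: "connected_matrix p \<Lambda>"
    and r_left: "\<And>l. l < p \<Longrightarrow> (\<Sum>j<p. r j * \<Lambda> $$ (j, l)) = r l"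
    and r_sum: "(\<Sum>j<p. r j) = 1"
    and v: "\<And>j. j < p \<Longrightarrow> v j \<in> carrier_vec n"
    and eq: "\<And>i a. i < p \<Longrightarrow> a < n \<Longrightarrow> (\<Sum>j<p. (cmat (error_block n (transpose_mat A)
        (transpose_mat C * transpose_mat L) (\<lambda>i j. \<Lambda> $$ (i, j)) r i j) *\<^sub>v v j) $ a) = \<mu> * v i $ a"
    and \<mu>: "1 \<le> cmod \<mu>" and i: "i < p"
  shows "v i = 0\<^sub>v n"
proof -
  obtain q where q: "q < p" "\<And>i. i < p \<Longrightarrow> (i, q) \<in> (mat_arcs p \<Lambda>)\<^sup>*"
    using connected_matrix_root[OF conn] by blast
  let ?A = "cmat (transpose_mat A)" and ?M = "cmat (transpose_mat C * transpose_mat L)"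
  let ?c = "\<lambda>i j. complex_of_real (\<Lambda> $$ (i, j))" and ?r = "\<lambda>j. complex_of_real (r j)"
  have cA: "?A \<in> carrier_mat n n" and cM: "?M \<in> carrier_mat n n" using A C L by auto
  let ?f = "\<lambda>i. ?A *\<^sub>v v i + ?M *\<^sub>v (weighted_sum n p (?c i) v - v i)"
  have f: "?f i \<in> carrier_vec n" if "i < p" for i using v[OF that] cA cM by simp
  let ?s = "weighted_sum n p ?r v"
  have As: "?A *\<^sub>v ?s \<in> carrier_vec n" using cA by simp
  have "cmat (error_block n (transpose_mat A) (transpose_mat C * transpose_mat L) (\<lambda>i j. \<Lambda> $$ (i, j)) r i j)
      = error_block n ?A ?M ?c ?r i j" for i j
    using A C L by (intro eq_matI) (auto simp: error_block_def)
  then have eq': "?f i $ a - (?A *\<^sub>v ?s) $ a = \<mu> * v i $ a" if "i < p" "a < n" for i a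
    using eq[OF that] sum_error_block[OF cA cM v that, where c = ?c and r = ?r] by simp
  have r1: "(\<Sum>j<p. ?r j) = 1" using r_sum by (simp flip: of_real_sum)
  have r_left': "(\<Sum>j<p. ?r j * ?c j l) = ?r l" if "l < p" for l
    using r_left[OF that] by (simp flip: of_real_mult of_real_sum)
  have avg: "weighted_sum n p ?r ?f = ?A *\<^sub>v ?s"
    by (rule left_eigenvector_average[where c = ?c, OF cA cM v r_left'])
  have s0: "?s = 0\<^sub>v n"
  proof (rule eq_vecI)
    fix a assume "a < dim_vec (0\<^sub>v n :: complex vec)"
    then have a: "a < n" by simp
    have "\<mu> * ?s $ a = (\<Sum>j<p. ?r j * (\<mu> * v j $ a))"
      using a by (simp add: weighted_sum_def sum_distrib_left mult_ac)
    also have "\<dots> = (\<Sum>j<p. ?r j * (?f j $ a - (?A *\<^sub>v ?s) $ a))"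
      using eq' a by (intro sum.cong) auto
    also have "\<dots> = (\<Sum>j<p. ?r j * ?f j $ a) - (\<Sum>j<p. ?r j) * (?A *\<^sub>v ?s) $ a"
      by (simp only: right_diff_distrib sum_subtractf sum_distrib_right)
    also have "\<dots> = weighted_sum n p ?r ?f $ a - (?A *\<^sub>v ?s) $ a"
      using a r1 by (simp add: weighted_sum_def)
    also have "\<dots> = 0" unfolding avg by simp
    finally show "?s $ a = 0\<^sub>v n $ a" using \<mu> a by auto
  qed (simp add: weighted_sum_def)
  have "?A *\<^sub>v ?s = 0\<^sub>v n" unfolding s0 by (rule mat_mult_vec_zero[OF cA])
  then have feq: "?f i = \<mu> \<cdot>\<^sub>v v i" if "i < p" for i
    using eq'[OF that] f[OF that] v[OF that] by (intro eq_vecI) (auto simp del: index_add_vec)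
  have sync: "v j = v q" if "j < p" for j
    by (rule gain_modes_synchronized[OF A C stable det gain conn q v \<mu> feq that])
  have "?s = v q"
    using sync r1 v[OF q(1)]
    by (intro eq_vecI) (auto simp: weighted_sum_def simp flip: sum_distrib_right)
  then show ?thesis using s0 sync[OF i] by simp
qed

section \<open>From modes to trajectories: convergence to the weighted average\<close>

theorem theorem3:
  fixes n m p :: nat
    and A C L \<Lambda> :: "real mat"
    and x u z :: "nat \<Rightarrow> nat \<Rightarrow> real vec"
    and r :: "real vec"
  assumes A: "A \<in> carrier_mat n n" and C: "C \<in> carrier_mat m n"
    and stable: "neutrally_stable A"
    and stab: "stabilizable (transpose_mat A) (transpose_mat C)"
    and gain: "constructed_gain n m A C L"
    and p: "p \<ge> 1"
    and conn: "connected_matrix p \<Lambda>"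
    and init: "\<And>i. i < p \<Longrightarrow> x i 0 \<in> carrier_vec n"
    and state: "\<And>i k. i < p \<Longrightarrow>
      x i (Suc k) = transpose_mat A *\<^sub>v x i k + transpose_mat C *\<^sub>v u i k"
    and input: "\<And>i k. i < p \<Longrightarrow> u i k = transpose_mat L *\<^sub>v z i k"
    and coupling: "\<And>i k. i < p \<Longrightarrow>
      z i k = finsum_vec TYPE(real) n (\<lambda>j. \<Lambda> $$ (i, j) \<cdot>\<^sub>v (x j k - x i k)) {..<p}"
    and r: "r \<in> carrier_vec p"
    and r_left: "mat_of_row r * \<Lambda> = mat_of_row r"
    and r_sum: "r \<bullet> vec p (\<lambda>_. 1) = 1"
  shows "\<forall>i < p. (\<lambda>k. vec_norm2 (x i k -
      kronecker_prod (mat_of_row r) (transpose_mat (A ^\<^sub>m k)) *\<^sub>v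
        stack_vecs p n (\<lambda>j. x j 0))) \<longlonglongrightarrow> 0"
proof (intro allI impI)
  fix i assume i: "i < p"
  have det: "detectable C A" using stab by (simp add: stabilizable_def)
  have L: "L \<in> carrier_mat n m"
  proof (cases "num_unit_eigenvalues A = 0")
    case True
    then show ?thesis using gain by (simp add: constructed_gain_def)
  next
    case False
    then show ?thesis using constructed_gain_data[OF A C gain refl] by blast
  qed
  have At: "transpose_mat A \<in> carrier_mat n n" and Ct: "transpose_mat C \<in> carrier_mat n m"
    and Lt: "transpose_mat L \<in> carrier_mat m n" using A C L by auto
  define M where "M = transpose_mat C * transpose_mat L"
  have M: "M \<in> carrier_mat n n" using Ct Lt by (simp add: M_def)
  have \<Lambda>: "\<Lambda> \<in> carrier_mat p p" using conn by (simp add: connected_matrix_def)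
  have rs: "(\<Sum>j<p. r $ j) = 1"
    using r_sum r by (simp add: scalar_prod_def atLeast0LessThan)
  have rl: "(\<Sum>j<p. r $ j * \<Lambda> $$ (j, l)) = r $ l" if l: "l < p" for l
  proof -
    have "(mat_of_row r * \<Lambda>) $$ (0, l) = (\<Sum>j<p. r $ j * \<Lambda> $$ (j, l))"
      using l r \<Lambda> by (simp add: scalar_prod_def atLeast0LessThan)
    then show ?thesis unfolding r_left using l r by (simp add: mat_of_row_def)
  qed
  have row1: "(\<Sum>j<p. \<Lambda> $$ (i, j)) = 1" if "i < p" for i
    using conn that by (simp add: connected_matrix_def)
  let ?ws = "\<lambda>i v. weighted_sum n p (\<lambda>j. \<Lambda> $$ (i, j)) v"
  \<comment> \<open>Only the initial states come with a dimension; the recursion propagates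
    it.\<close>
  have "x i k \<in> carrier_vec n" if "i < p" for i k
    using that
  proof (induction k arbitrary: i)
    case 0
    then show ?case by (rule init)
  next
    case (Suc k)
    have "u i k \<in> carrier_vec m"
      unfolding input[OF Suc.prems] coupling[OF Suc.prems] using Suc Lt
      by (intro mult_mat_vec_carrier[OF Lt] finsum_vec_closed) auto
    then show ?case unfolding state[OF Suc.prems] using At Ct Suc by simp
  qed
  note x = this
  \<comment> \<open>As each row of \<Lambda> sums to one, the weighted differences add up to the
    weighted average minus the node's own state.\<close>
  have z: "z i k = ?ws i (\<lambda>j. x j k) - x i k" if i: "i < p" for i k
  proof -
    have d: "\<Lambda> $$ (i, j) \<cdot>\<^sub>v (x j k - x i k) \<in> carrier_vec n" for j
      using carrier_vecD[OF x[OF i]] by (intro carrier_vecI) simp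
    have "z i k = ?ws i (\<lambda>j. x j k - x i k)"
    proof (rule eq_vecI)
      fix a assume "a < dim_vec (?ws i (\<lambda>j. x j k - x i k))"
      then have a: "a < n" by (simp add: weighted_sum_def)
      have "z i k $ a = (\<Sum>j<p. (\<Lambda> $$ (i, j) \<cdot>\<^sub>v (x j k - x i k)) $ a)"
        unfolding coupling[OF i] using d by (intro index_finsum_vec[OF _ a]) auto
      then show "z i k $ a = ?ws i (\<lambda>j. x j k - x i k) $ a"
        using a carrier_vecD[OF x[OF i]] by (simp add: weighted_sum_def)
    next
      have "z i k \<in> carrier_vec n"
        unfolding coupling[OF i] using d by (intro finsum_vec_closed) auto
      then show "dim_vec (z i k) = dim_vec (?ws i (\<lambda>j. x j k - x i k))" by (simp add: weighted_sum_def)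
    qed
    also have "\<dots> = ?ws i (\<lambda>j. x j k) - x i k"
      by (rule weighted_sum_diff[OF row1[OF i] x x[OF i]])
    finally show ?thesis .
  qed
  have x_Suc: "x i (Suc k) = transpose_mat A *\<^sub>v x i k + M *\<^sub>v (?ws i (\<lambda>j. x j k) - x i k)"
    if i: "i < p" for i k
  proof -
    have "?ws i (\<lambda>j. x j k) - x i k \<in> carrier_vec n" using x[OF i] by simp
    then show ?thesis
      unfolding state[OF i] input[OF i] z[OF i] M_def by (simp add: assoc_mult_mat_vec[OF Ct Lt])
  qed
  define X where "X k = weighted_sum n p (($) r) (\<lambda>j. x j k)" for k
  have X: "X k \<in> carrier_vec n" for k by (simp add: X_def)
  have X_Suc: "X (Suc k) = transpose_mat A *\<^sub>v X k" for k
  proof -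
    have "X (Suc k) = weighted_sum n p (($) r)
        (\<lambda>j. transpose_mat A *\<^sub>v x j k + M *\<^sub>v (?ws j (\<lambda>j. x j k) - x j k))"
      using x_Suc by (simp add: X_def weighted_sum_def)
    also have "\<dots> = transpose_mat A *\<^sub>v X k"
      unfolding X_def by (rule left_eigenvector_average[OF At M x rl])
    finally show ?thesis .
  qed
  have Ak: "A ^\<^sub>m k \<in> carrier_mat n n" for k using A by simp
  have X_pow: "X k = transpose_mat (A ^\<^sub>m k) *\<^sub>v X 0" for k
  proof (induction k)
    case 0
    then show ?case using X[of 0] A by simp
  next
    case (Suc k)
    have "transpose_mat (A ^\<^sub>m Suc k) *\<^sub>v X 0 = (transpose_mat A * transpose_mat (A ^\<^sub>m k)) *\<^sub>v X 0"
      using transpose_mult[OF Ak A] by simp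
    also have "\<dots> = transpose_mat A *\<^sub>v (transpose_mat (A ^\<^sub>m k) *\<^sub>v X 0)"
      by (rule assoc_mult_mat_vec[OF At _ X]) (use Ak in simp)
    finally show ?case using X_Suc Suc by simp
  qed
  define e where "e i k = x i k - X k" for i k
  have e: "e i k \<in> carrier_vec n" if "i < p" for i k using x[OF that] X by (simp add: e_def)
  have step: "e i (Suc k) $ a = (\<Sum>j<p. (error_block n (transpose_mat A) M (\<lambda>i j. \<Lambda> $$ (i, j)) (($) r) i j *\<^sub>v e j k) $ a)"
    if i: "i < p" and a: "a < n" for i k a
  proof -
    have "?ws i (\<lambda>j. e j k) = ?ws i (\<lambda>j. x j k) - X k"
      unfolding e_def by (rule weighted_sum_diff[OF row1[OF i] x X])
    then have wse: "?ws i (\<lambda>j. e j k) - e i k = ?ws i (\<lambda>j. x j k) - x i k"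
      unfolding e_def using carrier_vecD[OF x[OF i]] carrier_vecD[OF X]
      by (intro eq_vecI) (auto simp: weighted_sum_def)
    \<comment> \<open>The errors have average zero under \<open>r\<close>, so the multiples of
      \<open>transpose_mat A\<close> subtracted in \<open>error_block\<close> contribute nothing
      along the trajectory.\<close>
    have "weighted_sum n p (($) r) (\<lambda>j. x j k - X k) = weighted_sum n p (($) r) (\<lambda>j. x j k) - X k"
      by (rule weighted_sum_diff[OF rs x X])
    then have "weighted_sum n p (($) r) (\<lambda>j. e j k) = X k - X k"
      by (simp add: e_def X_def)
    then have r0: "weighted_sum n p (($) r) (\<lambda>j. e j k) = 0\<^sub>v n" using X by simp
    have d: "?ws i (\<lambda>j. x j k) - x i k \<in> carrier_vec n" using x[OF i] by simp
    have Ae: "transpose_mat A *\<^sub>v e i k = transpose_mat A *\<^sub>v x i k - transpose_mat A *\<^sub>v X k"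
      unfolding e_def by (rule mult_minus_distrib_mat_vec[OF At x[OF i] X])
    have "(\<Sum>j<p. (error_block n (transpose_mat A) M (\<lambda>i j. \<Lambda> $$ (i, j)) (($) r) i j *\<^sub>v e j k) $ a)
        = (transpose_mat A *\<^sub>v e i k + M *\<^sub>v (?ws i (\<lambda>j. e j k) - e i k)) $ a
          - (transpose_mat A *\<^sub>v weighted_sum n p (($) r) (\<lambda>j. e j k)) $ a"
      by (rule sum_error_block[OF At M e i a])
    also have "\<dots> = (transpose_mat A *\<^sub>v e i k + M *\<^sub>v (?ws i (\<lambda>j. x j k) - x i k)) $ a"
      unfolding wse r0 mat_mult_vec_zero[OF At] using a by simp
    also have "\<dots> = e i (Suc k) $ a"
      unfolding Ae unfolding e_def x_Suc[OF i] X_Suc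
      using a At M by (simp del: index_mult_mat_vec)
    finally show ?thesis by simp
  qed
  have "(\<lambda>k. e i k $ a) \<longlonglongrightarrow> 0" if a: "a < n" for a
  proof (rule block_system_tendsto_0[where e = e and
        K = "error_block n (transpose_mat A) M (\<lambda>i j. \<Lambda> $$ (i, j)) (($) r)",
        OF error_block_carrier e step _ i a])
    show "v i = 0\<^sub>v n" if "\<And>j. j < p \<Longrightarrow> v j \<in> carrier_vec n"
      "\<And>i a. i < p \<Longrightarrow> a < n \<Longrightarrow> (\<Sum>j<p. (cmat (error_block n (transpose_mat A) M (\<lambda>i j. \<Lambda> $$ (i, j)) (($) r) i j) *\<^sub>v v j) $ a)
        = \<mu> * v i $ a" "1 \<le> cmod \<mu>" "i < p" for \<mu> v i
      by (rule error_block_no_unstable_mode[OF A C L stable det gain conn rl rs that[unfolded M_def]])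
  qed
  then have "(\<lambda>k. sqrt (\<Sum>a<n. e i k $ a * e i k $ a)) \<longlonglongrightarrow> sqrt (\<Sum>a<n. 0 * 0)"
    by (intro tendsto_intros) auto
  moreover have "vec_norm2 (x i k - kronecker_prod (mat_of_row r) (transpose_mat (A ^\<^sub>m k)) *\<^sub>v
      stack_vecs p n (\<lambda>j. x j 0)) = sqrt (\<Sum>a<n. e i k $ a * e i k $ a)" for k
  proof -
    \<comment> \<open>\<open>X 0\<close> is the average of the initial states, so the prescribed
      limit trajectory is \<open>X\<close> itself and its distance from \<open>x i k\<close> is the
      norm of \<open>e i k\<close>.\<close>
    have "kronecker_prod (mat_of_row r) (transpose_mat (A ^\<^sub>m k)) *\<^sub>v stack_vecs p n (\<lambda>j. x j 0) = X k"
      unfolding X_pow[of k] unfolding X_def by (rule kronecker_row_mult_stack[OF _ r init]) (use Ak in simp)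
    then have "x i k - kronecker_prod (mat_of_row r) (transpose_mat (A ^\<^sub>m k)) *\<^sub>v
      stack_vecs p n (\<lambda>j. x j 0) = e i k" by (simp add: e_def)
    then show ?thesis
      using carrier_vecD[OF e[OF i]] by (simp add: vec_norm2_def scalar_prod_def atLeast0LessThan)
  qed
  ultimately show "(\<lambda>k. vec_norm2 (x i k - kronecker_prod (mat_of_row r) (transpose_mat (A ^\<^sub>m k)) *\<^sub>v
        stack_vecs p n (\<lambda>j. x j 0))) \<longlonglongrightarrow> 0" by simp
qed

end
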